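(* Let $\phi:(0,+\infty)\to[0,+\infty)$ be a $C^1$ function and let $\Phi(t)=\int_0^{|t|}s\phi(s)\,ds$ for $t\in\mathbb{R}$. Assume: ($\phi_1$) $\phi(t)>0$ and $(\phi(t)t)'>0$ for all $t>0$; ($\phi_2$) there are $l,m\in\mathbb{R}$ with $1<l\le m$ such that $l-1\le \frac{(\phi(t)t)'}{\phi(t)}\le m-1$ for all $t>0$; ($\phi_3$) there are constants $k_1,k_2,\delta_0>0$ and $\sigma>1$ such that $k_1t^{\sigma-1}\le\phi(t)t\le k_2t^{\sigma-1}$ for all $t\in(0,\delta_0]$. Let $V:\mathbb{R}\to\mathbb{R}$ satisfy: ($V_1$) $V\in C^1(\mathbb{R},\mathbb{R})$ and $V\ge 0$ on $\mathbb{R}$; ($V_2$) there is $\alpha>0$ such that $V(\alpha)=V(-\alpha)=0$ and $V(t)>0$ for all $t\in(-\alpha,\alpha)$; ($V_3$) there are $a_1,a_2,a_3,a_4>0$ and $\delta\in(0,\alpha)$ such that $a_1\Phi(|t-\alpha|)\le V(t)\le a_2\Phi(|t-\alpha|)$ for all $t\in(\alpha-\delta,\alpha]$ and $a_3\Phi(|t+\alpha|)\le V(t)\le a_4\Phi(|t+\alpha|)$ for all $t\in[-\alpha,-\alpha+\delta)$; ($V_4$) there are $c_1,\dots,c_8>0$ such that $-c_3t\phi(c_4|t-\alpha|)|t-\alpha|\le V'(t)\le -c_1t\phi(c_2|t-\alpha|)|t-\alpha|$ for all $t\in[0,\alpha]$ and $-c_7t\phi(c_8|t+\alpha|)|t+\alpha|\le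 V'(t)\le -c_5t\phi(c_6|t+\alpha|)|t+\alpha|$ for all $t\in[-\alpha,0]$; ($V_5$) there is $\rho>0$ such that $V$ is strictly convex on $(-\alpha-\rho,-\alpha+\rho)$ and on $(\alpha-\rho,\alpha+\rho)$. Then the problem $$-\left(\phi(|u'|)u'\right)'+V'(u)=0\ \text{ in }\mathbb{R},\qquad u(0)=0,\qquad u(\pm\infty)=\pm\alpha,$$ has a unique twice differentiable solution $q$ in $C^{1,\gamma}_{\mathrm{loc}}(\mathbb{R})$ for some $\gamma\in(0,1)$. Moreover: (a) If in addition $\phi:[0,+\infty)\to[0,+\infty)$ (i.e. $\phi$ is also defined at $0$) and $\phi$ is non-decreasing, then there are $\theta_i,\beta_i>0$ ($i=1,\dots,4$) such that $$0<\alpha-q(t)\le\theta_1e^{-\theta_2t}\ \text{ and }\ 0<q'(t)\le\beta_1e^{-\beta_2t}\quad\text{for all }t\ge0,$$ $$0<\alpha+q(t)\le\theta_3e^{\theta_4t}\ \text{ and }\ 0<q'(t)\le\beta_3e^{\beta_4t}\quad\text{for all }t\le0.$$ (b) If $V(t)=\Phi(|t^2-\alpha^2|)$ for all $t\in\mathbb{R}$, then: (i) if $l-1\le1\le m-1$, then $\alpha\tanh\left(\frac{\alpha t}{m-1}\right)\le q(t)\le\alpha\tanh\left(\frac{\alpha t}{l-1}\right)$ for $t\ge0$; (ii) if $l-1>1$, then $\alpha\tanh\left(\frac{\alpha t}{m-1}\right)\le q(t)\le\alpha\tanh(\alpha t)$ for $t\ge0$; (iii) if $m-1<1$, then $\alpha\tanh(\alpha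 t)\le q(t)\le\alpha\tanh\left(\frac{\alpha t}{l-1}\right)$ for $t\ge0$.
   Context: $u(\pm\infty)=\pm\alpha$ means $\lim_{t\to+\infty}u(t)=\alpha$ and $\lim_{t\to-\infty}u(t)=-\alpha$. Expressions $\phi(|s|)s$ and $\phi(c|s|)|s|$ are read as $0$ at $s=0$. *)

theory Defs
  imports "HOL-Analysis.Analysis"
begin

text \<open>
  The function \<open>\<phi>\<close> lives on \<open>(0, \<infinity>)\<close> and is represented by a total function on the reals whose
  values outside \<open>(0, \<infinity>)\<close> play no role unless \<open>\<phi>\<close> is explicitly assumed to be defined at \<open>0\<close> too:
  wherever \<open>\<phi>\<close> is evaluated at \<open>0\<close> in the equation or a bound, it is multiplied by \<open>0\<close>, which realises the convention that \<open>\<phi>(|s|) s\<close> and \<open>\<phi>(c |s|) |s|\<close> are read as \<open>0\<close> at \<open>s = 0\<close>.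
\<close>

definition Phi :: "(real \<Rightarrow> real) \<Rightarrow> real \<Rightarrow> real"
  where "Phi \<phi> t = integral {0..\<bar>t\<bar>} (\<lambda>s. s * \<phi> s)"

definition strictly_convex_on :: "real set \<Rightarrow> (real \<Rightarrow> real) \<Rightarrow> bool"
  where "strictly_convex_on S f \<longleftrightarrow> convex S \<and>
    (\<forall>x\<in>S. \<forall>y\<in>S. \<forall>u>0. \<forall>v>0. x \<noteq> y \<and> u + v = 1 \<longrightarrow>
      f (u * x + v * y) < u * f x + v * f y)"

definition holder_continuous_on :: "real \<Rightarrow> real set \<Rightarrow> (real \<Rightarrow> real) \<Rightarrow> bool"
  where "holder_continuous_on \<gamma> S f \<longleftrightarrow>
    (\<exists>C. \<forall>s\<in>S. \<forall>t\<in>S. \<bar>f s - f t\<bar> \<le> C * \<bar>s - t\<bar> powr \<gamma>)"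

definition C1_holder_loc :: "real \<Rightarrow> (real \<Rightarrow> real) \<Rightarrow> bool"
  where "C1_holder_loc \<gamma> u \<longleftrightarrow> u C1_differentiable_on UNIV \<and>
    (\<forall>K. compact K \<longrightarrow> holder_continuous_on \<gamma> K (deriv u))"

definition twice_differentiable :: "(real \<Rightarrow> real) \<Rightarrow> bool"
  where "twice_differentiable u \<longleftrightarrow>
    (\<forall>t. u differentiable (at t)) \<and> (\<forall>t. deriv u differentiable (at t))"

text \<open>
  The equation is understood pointwise, so the flux \<open>\<phi>(|u'|) u'\<close> is required to be differentiable.
  For a \<open>C\<^sup>1\<close> function \<open>u\<close> and continuous \<open>V'\<close> this is the same as being a weak solution.
\<close>

definition heteroclinic_solution ::
    "(real \<Rightarrow> real) \<Rightarrow> (real \<Rightarrow> real) \<Rightarrow> real \<Rightarrow> (real \<Rightarrow> real) \<Rightarrow> bool"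
  where "heteroclinic_solution \<phi> V \<alpha> u \<longleftrightarrow>
    (\<forall>t. u differentiable (at t)) \<and>
    (\<forall>t. (\<lambda>s. \<phi> \<bar>deriv u s\<bar> * deriv u s) differentiable (at t)) \<and>
    (\<forall>t. - deriv (\<lambda>s. \<phi> \<bar>deriv u s\<bar> * deriv u s) t + deriv V (u t) = 0) \<and>
    u 0 = 0 \<and>
    (u \<longlongrightarrow> \<alpha>) at_top \<and>
    (u \<longlongrightarrow> - \<alpha>) at_bot"

definition regular_heteroclinic_solution ::
    "(real \<Rightarrow> real) \<Rightarrow> (real \<Rightarrow> real) \<Rightarrow> real \<Rightarrow> (real \<Rightarrow> real) \<Rightarrow> bool"
  where "regular_heteroclinic_solution \<phi> V \<alpha> u \<longleftrightarrow>
    heteroclinic_solution \<phi> V \<alpha> u \<and>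
    twice_differentiable u \<and>
    (\<exists>\<gamma>. 0 < \<gamma> \<and> \<gamma> < 1 \<and> C1_holder_loc \<gamma> u)"

end

theory Submission
  imports Defs
begin

text \<open>
  The equation is autonomous and conservative, so it can be solved by quadrature.  Write
  \<open>a(s) = \<phi>(|s|) s\<close> for the flux, so that \<open>\<Phi>' = a\<close>, and \<open>H(s) = a(s) s - \<Phi>(s)\<close> for the
  kinetic energy, the Legendre transform of \<open>\<Phi>\<close> evaluated at \<open>a(s)\<close>.  Every solution conserves
  \<open>H(u') - V(u)\<close>; for a heteroclinic solution both terms vanish at infinity, hence
  \<open>H(u') = V(u)\<close> (\<open>zero_energy\<close>).  As \<open>H\<close> is even and strictly increasing on
  \<open>[0, \<infinity>)\<close>, this determines \<open>|u'|\<close> as a function \<open>g(u) = H\<^sup>-\<^sup>1(V(u))\<close>.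

  The ellipticity bounds give \<open>(l - 1) \<Phi> \<le> H \<le> (m - 1) \<Phi>\<close>.  With the comparison of \<open>V\<close>
  and \<open>\<Phi>\<close> near the wells and the convexity of \<open>\<Phi>\<close> this yields
  \<open>c (\<alpha>\<^sup>2 - x\<^sup>2) \<le> g(x) \<le> C (\<alpha>\<^sup>2 - x\<^sup>2)\<close> for \<open>|x| < \<alpha>\<close> (\<open>ex_well_bounds\<close>).  The
  functions with \<open>w' = k (\<alpha>\<^sup>2 - w\<^sup>2)\<close> and \<open>w(0) = 0\<close> are \<open>w(t) = \<alpha> tanh(k \<alpha> t)\<close>, and
  comparison with them does all the rest.  The upper bound keeps a solution from reaching
  \<open>\<plusminus>\<alpha>\<close> in finite time (\<open>barrier\<close>); so \<open>u'\<close> has no zero, it is positive, and \<open>u' = g(u)\<close>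
  (\<open>transition_if_heteroclinic\<close>).  Separation of variables with \<open>T(x) = \<integral>\<^sub>0\<^sup>x d\<xi> / g(\<xi>)\<close> then
  gives \<open>T(u(t)) = t\<close>, which is uniqueness.  The upper bound also makes \<open>T\<close> map \<open>(-\<alpha>, \<alpha>)\<close>
  onto the line, so that \<open>T\<^sup>-\<^sup>1\<close> is a solution (\<open>ex_transition\<close>, \<open>transition_regular\<close>).
  The lower bound gives \<open>u(t) \<ge> \<alpha> tanh(c \<alpha> t)\<close> for \<open>t \<ge> 0\<close>, hence the limits at infinity and
  the exponential decay.

  If \<open>V(t) = \<Phi>(|t\<^sup>2 - \<alpha>\<^sup>2|)\<close>, the bounds on \<open>g\<close> hold with the explicit constants
  \<open>c = min(1, 1/(m-1))\<close> and \<open>C = max(1, 1/(l-1))\<close>; the three cases of the last statement are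
  the cases of this minimum and this maximum.
\<close>

section \<open>Monotone inverses, and comparison with the hyperbolic tangent\<close>

text \<open>
  A strictly increasing function, continuous or not, has a continuous inverse on its image.
  Stated for a function \<open>f\<close> that is only known through \<open>F \<circ> f\<close>, this yields the
  continuity of \<open>u'\<close> from that of the flux, and of the inverses of the kinetic energy and of the
  travel time.
\<close>

lemma tendsto_if_strict_mono_image_tendsto:
  fixes F :: "real \<Rightarrow> real" and f :: "'a \<Rightarrow> real"
  assumes mono: "strict_mono_on S F" and S: "open S" "L \<in> S"
    and ev: "eventually (\<lambda>x. f x \<in> S) A"
    and lim: "((\<lambda>x. F (f x)) \<longlongrightarrow> F L) A"
  shows "(f \<longlongrightarrow> L) A"
proof -
  obtain e where e: "e > 0" "\<And>y. \<bar>y - L\<bar> < e \<Longrightarrow> y \<in> S"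
    using S by (metis openE mem_ball dist_real_def dist_commute subsetD)
  show ?thesis
  proof (rule order_tendstoI)
    fix c assume "c < L"
    define c' where "c' = max c (L - e / 2)"
    have c': "c' \<in> S" "c' < L" "c \<le> c'"
      using \<open>c < L\<close> e by (auto simp: c'_def)
    have "eventually (\<lambda>x. F c' < F (f x)) A"
      using order_tendstoD(1)[OF lim] strict_mono_onD[OF mono c'(1) S(2) c'(2)] by blast
    with ev show "eventually (\<lambda>x. c < f x) A"
    proof eventually_elim
      case (elim x)
      then show ?case using strict_mono_onD[OF mono _ c'(1), of "f x"] c'(3)
        by (metis le_less_trans less_le_not_le linorder_not_le order_le_less)
    qed
  next
    fix c assume "L < c"
    define c' where "c' = min c (L + e / 2)"
    have c': "c' \<in> S" "L < c'" "c' \<le> c"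
      using \<open>L < c\<close> e by (auto simp: c'_def)
    have "eventually (\<lambda>x. F (f x) < F c') A"
      using order_tendstoD(2)[OF lim] strict_mono_onD[OF mono S(2) c'(1) c'(2)] by blast
    with ev show "eventually (\<lambda>x. f x < c) A"
    proof eventually_elim
      case (elim x)
      then show ?case using strict_mono_onD[OF mono c'(1), of "f x"] c'(3)
        by (metis less_le_trans less_le_not_le linorder_not_le order_le_less)
    qed
  qed
qed

lemma tanh_artanh_real:
  assumes "\<bar>y\<bar> < (1::real)"
  shows "tanh (artanh y) = y"
proof -
  have p: "(1 + y) / (1 - y) > 0" using assms by auto
  have "exp (- 2 * artanh y) = (1 - y) / (1 + y)"
    using p by (simp add: artanh_def exp_minus)
  then show ?thesis using assms
    by (simp add: tanh_real_altdef) (simp add: field_simps)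
qed

lemma square_less_if_abs_less: "\<bar>x\<bar> < a \<Longrightarrow> x\<^sup>2 < (a::real)\<^sup>2"
  by (metis abs_ge_zero power2_abs power_strict_mono zero_less_numeral)

lemma artanh_scaled_derivative:
  fixes u :: "real \<Rightarrow> real"
  assumes "\<alpha> > 0" "\<bar>u s\<bar> < \<alpha>" "(u has_real_derivative d) (at s)"
  shows "((\<lambda>s. artanh (u s / \<alpha>)) has_real_derivative \<alpha> * d / (\<alpha>\<^sup>2 - (u s)\<^sup>2)) (at s)"
proof -
  have "\<bar>u s / \<alpha>\<bar> < 1" using assms by auto
  moreover have "(1 / (1 - (u s / \<alpha>)\<^sup>2)) * (d / \<alpha>) = \<alpha> * d / (\<alpha>\<^sup>2 - (u s)\<^sup>2)"
  proof -
    have "(u s)\<^sup>2 < \<alpha>\<^sup>2" using assms by (intro square_less_if_abs_less)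
    then show ?thesis using assms(1)
      by (simp add: field_simps power2_eq_square)
  qed
  moreover have "((\<lambda>s. u s / \<alpha>) has_real_derivative d / \<alpha>) (at s)"
    using assms by (intro DERIV_cdivide)
  ultimately show ?thesis
    using DERIV_chain2[where f = artanh and g = "\<lambda>s. u s / \<alpha>" and x = s and s = UNIV,
      OF artanh_real_has_field_derivative] by fastforce
qed

text \<open>
  In the variable \<open>artanh (u / \<alpha>)\<close> the differential inequality becomes a bound by the constant
  slope \<open>k * \<alpha>\<close>.
\<close>

lemma tanh_comparison_upper:
  fixes u :: "real \<Rightarrow> real"
  assumes "\<alpha> > 0" "t \<ge> 0" "u 0 = 0"
    and bd: "\<And>s. 0 \<le> s \<Longrightarrow> s \<le> t \<Longrightarrow> \<bar>u s\<bar> < \<alpha>"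
    and der: "\<And>s. 0 \<le> s \<Longrightarrow> s \<le> t \<Longrightarrow> (u has_real_derivative u' s) (at s)"
    and le: "\<And>s. 0 \<le> s \<Longrightarrow> s \<le> t \<Longrightarrow> u' s \<le> k * (\<alpha>\<^sup>2 - (u s)\<^sup>2)"
  shows "u t \<le> \<alpha> * tanh (k * \<alpha> * t)"
proof -
  have "k * \<alpha> * 0 - artanh (u 0 / \<alpha>) \<le> k * \<alpha> * t - artanh (u t / \<alpha>)"
  proof (rule DERIV_nonneg_imp_nondecreasing[OF \<open>t \<ge> 0\<close>])
    fix s assume s: "0 \<le> s" "s \<le> t"
    have pos: "(u s)\<^sup>2 < \<alpha>\<^sup>2" by (intro square_less_if_abs_less bd s)
    have "((\<lambda>s. k * \<alpha> * s - artanh (u s / \<alpha>)) has_real_derivative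
        k * \<alpha> - \<alpha> * u' s / (\<alpha>\<^sup>2 - (u s)\<^sup>2)) (at s)"
      by (auto intro!: derivative_eq_intros artanh_scaled_derivative[OF assms(1) bd[OF s] der[OF s]])
    moreover have "\<alpha> * u' s / (\<alpha>\<^sup>2 - (u s)\<^sup>2) \<le> k * \<alpha>"
      using mult_left_mono[OF le[OF s], of \<alpha>] pos assms(1) by (simp add: divide_le_eq algebra_simps)
    ultimately show "\<exists>y. ((\<lambda>s. k * \<alpha> * s - artanh (u s / \<alpha>)) has_real_derivative y) (at s) \<and> 0 \<le> y"
      by force
  qed
  then have "artanh (u t / \<alpha>) \<le> k * \<alpha> * t" using assms(3) by simp
  then have "tanh (artanh (u t / \<alpha>)) \<le> tanh (k * \<alpha> * t)" by simp
  moreover have "tanh (artanh (u t / \<alpha>)) = u t / \<alpha>"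
    using bd[of t] assms by (intro tanh_artanh_real) auto
  ultimately show ?thesis using assms(1) by (simp add: field_simps)
qed

lemma tanh_comparison_lower:
  fixes u :: "real \<Rightarrow> real"
  assumes "\<alpha> > 0" "t \<ge> 0" "u 0 = 0"
    and bd: "\<And>s. 0 \<le> s \<Longrightarrow> s \<le> t \<Longrightarrow> \<bar>u s\<bar> < \<alpha>"
    and der: "\<And>s. 0 \<le> s \<Longrightarrow> s \<le> t \<Longrightarrow> (u has_real_derivative u' s) (at s)"
    and ge: "\<And>s. 0 \<le> s \<Longrightarrow> s \<le> t \<Longrightarrow> k * (\<alpha>\<^sup>2 - (u s)\<^sup>2) \<le> u' s"
  shows "\<alpha> * tanh (k * \<alpha> * t) \<le> u t"
proof -
  have "- u t \<le> \<alpha> * tanh (- k * \<alpha> * t)"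
    by (rule tanh_comparison_upper[where u' = "\<lambda>s. - u' s"])
       (use assms in \<open>auto intro!: DERIV_minus\<close>)
  then show ?thesis by simp
qed

text \<open>
  At a first time \<open>b\<close> with \<open>\<bar>u b\<bar> \<ge> \<alpha>\<close> the comparison would hold on all of \<open>[0, b)\<close>, and in
  the limit give \<open>\<bar>u b\<bar> \<le> \<alpha> * tanh (C * \<alpha> * b) < \<alpha>\<close>.
\<close>

lemma barrier_forward:
  fixes u :: "real \<Rightarrow> real"
  assumes "\<alpha> > 0" "u 0 = 0"
    and der: "\<And>s. (u has_real_derivative u' s) (at s)"
    and le: "\<And>s. \<bar>u s\<bar> < \<alpha> \<Longrightarrow> \<bar>u' s\<bar> \<le> C * (\<alpha>\<^sup>2 - (u s)\<^sup>2)"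
    and "t \<ge> 0"
  shows "\<bar>u t\<bar> < \<alpha>"
proof (rule ccontr)
  assume "\<not> \<bar>u t\<bar> < \<alpha>"
  define Z where "Z = {s \<in> {0..t}. \<bar>u s\<bar> \<ge> \<alpha>}"
  have cont: "continuous_on A u" for A
    using der DERIV_continuous_on has_field_derivative_at_within by blast
  have "closed ({0..t} \<inter> (\<lambda>s. \<bar>u s\<bar>) -` {\<alpha>..})"
    by (intro continuous_closed_preimage continuous_intros cont)
  then have "closed Z"
    by (rule back_subst[of closed]) (auto simp: Z_def)
  then have "compact Z"
    unfolding compact_eq_bounded_closed
    by (auto simp: Z_def intro: bounded_subset[OF bounded_closed_interval[of 0 t]])
  moreover have "t \<in> Z" using \<open>\<not> \<bar>u t\<bar> < \<alpha>\<close> \<open>t \<ge> 0\<close> by (auto simp: Z_def)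
  ultimately obtain b where b: "b \<in> Z" "\<And>s. s \<in> Z \<Longrightarrow> b \<le> s"
    using compact_attains_inf[of Z] by blast
  have bt: "0 \<le> b" "b \<le> t" "\<alpha> \<le> \<bar>u b\<bar>" using b by (auto simp: Z_def)
  have in0: "\<bar>u s\<bar> < \<alpha>" if "0 \<le> s" "s < b" for s
    using b(2)[of s] that bt by (force simp: Z_def)
  have "b > 0" using bt assms by (cases "b = 0") auto
  have bound: "\<bar>u s\<bar> \<le> \<alpha> * tanh (C * \<alpha> * s)" if "0 \<le> s" "s < b" for s
  proof -
    have "u s \<le> \<alpha> * tanh (C * \<alpha> * s)"
      using that le[OF in0] by (intro tanh_comparison_upper[OF assms(1) _ assms(2) _ der] in0) (fastforce)+
    moreover have "\<alpha> * tanh (- C * \<alpha> * s) \<le> u s"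
      using that le[OF in0] by (intro tanh_comparison_lower[OF assms(1) _ assms(2) _ der] in0) (fastforce)+
    ultimately show ?thesis by simp
  qed
  have "\<bar>u b\<bar> \<le> \<alpha> * tanh (C * \<alpha> * b)"
  proof (rule tendsto_le[OF trivial_limit_at_left_real])
    have "isCont u b" using der DERIV_isCont by blast
    then show "((\<lambda>s. \<bar>u s\<bar>) \<longlongrightarrow> \<bar>u b\<bar>) (at_left b)"
      by (intro tendsto_rabs) (simp add: continuous_at_imp_continuous_at_within continuous_within isCont_def filterlim_at_split)
    show "((\<lambda>s. \<alpha> * tanh (C * \<alpha> * s)) \<longlongrightarrow> \<alpha> * tanh (C * \<alpha> * b)) (at_left b)"
      by (intro tendsto_intros) auto
    show "\<forall>\<^sub>F s in at_left b. \<bar>u s\<bar> \<le> \<alpha> * tanh (C * \<alpha> * s)"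
      using eventually_at_left_real[OF \<open>b > 0\<close>] by eventually_elim (use bound in auto)
  qed
  moreover have "\<alpha> * tanh (C * \<alpha> * b) < \<alpha>"
    using assms(1) tanh_real_lt_1 by (simp add: mult_less_cancel_left_pos)
  ultimately show False using bt by simp
qed

text \<open>
  The substitution \<open>u(t) \<mapsto> - u(- t)\<close> exchanges the two half-lines and carries the forward
  statements over to negative times.
\<close>

lemma reflect_derivative:
  fixes u :: "real \<Rightarrow> real"
  assumes "(u has_real_derivative d) (at (- s))"
  shows "((\<lambda>s. - u (- s)) has_real_derivative d) (at s)"
proof -
  have "((\<lambda>s. u (- s)) has_real_derivative d * (- 1)) (at s)"
    by (rule DERIV_chain2[where f = u and g = uminus, OF assms]) (auto intro!: derivative_eq_intros)
  from DERIV_minus[OF this] show ?thesis by simp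
qed

lemma barrier:
  fixes u :: "real \<Rightarrow> real"
  assumes "\<alpha> > 0" "u 0 = 0"
    and der: "\<And>s. (u has_real_derivative u' s) (at s)"
    and le: "\<And>s. \<bar>u s\<bar> < \<alpha> \<Longrightarrow> \<bar>u' s\<bar> \<le> C * (\<alpha>\<^sup>2 - (u s)\<^sup>2)"
  shows "\<bar>u t\<bar> < \<alpha>"
proof (cases "t \<ge> 0")
  case True
  then show ?thesis using barrier_forward[OF assms] by blast
next
  case False
  have "\<bar>- u (- (- t))\<bar> < \<alpha>"
    by (rule barrier_forward[where u' = "\<lambda>s. u' (- s)" and C = C])
       (use assms False in \<open>auto intro!: reflect_derivative\<close>)
  then show ?thesis by simp
qed

lemma one_minus_tanh_le: "1 - tanh x \<le> 2 * exp (- 2 * x)" for x :: real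
proof -
  have "1 - tanh x = 2 * exp (- 2 * x) / (1 + exp (- 2 * x))"
    by (simp add: tanh_real_altdef field_simps add_pos_pos add_nonneg_eq_0_iff)
  also have "\<dots> \<le> 2 * exp (- 2 * x) / 1"
    by (intro divide_left_mono) (auto intro: add_pos_pos)
  finally show ?thesis by simp
qed

section \<open>A local Hoelder estimate and a power-law limit\<close>

text \<open>
  A locally bounded derivative gives a local Lipschitz bound, and
  \<open>\<bar>s - t\<bar> \<le> sqrt (2 * r) * \<bar>s - t\<bar> powr (1/2)\<close> on \<open>[- r, r]\<close>.  Any exponent in \<open>(0, 1)\<close> would
  serve in place of \<open>1/2\<close>.
\<close>

lemma holder_on_compact_if_derivative_bounded:
  fixes w w' b :: "real \<Rightarrow> real"
  assumes der: "\<And>t. (w has_real_derivative w' t) (at t)"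
    and le: "\<And>t. \<bar>w' t\<bar> \<le> b t" and b: "continuous_on UNIV b" and "compact K"
  shows "holder_continuous_on (1/2) K w"
proof -
  obtain r where r: "r > 0" "\<And>x. x \<in> K \<Longrightarrow> \<bar>x\<bar> \<le> r"
    using compact_imp_bounded[OF \<open>compact K\<close>] by (auto simp: bounded_pos)
  have "\<exists>x\<in>{-r..r}. \<forall>y\<in>{-r..r}. b y \<le> b x"
    using r by (intro continuous_attains_sup continuous_on_subset[OF b]) auto
  then obtain B where B: "\<And>y. y \<in> {-r..r} \<Longrightarrow> b y \<le> B" by blast
  have "B \<ge> 0" using B[of 0] le[of 0] r(1) by force
  have "\<bar>w s - w t\<bar> \<le> B * sqrt (2 * r) * \<bar>s - t\<bar> powr (1/2)" if "s \<in> K" "t \<in> K" for s t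
  proof -
    have "norm (w s - w t) \<le> B * norm (s - t)"
    proof (rule field_differentiable_bound[of "{-r..r}" w w'])
      show "(w has_field_derivative w' z) (at z within {- r..r})" for z
        using der by (rule has_field_derivative_at_within)
      show "norm (w' z) \<le> B" if "z \<in> {-r..r}" for z
        using le[of z] B[OF that] by simp
    qed (use r(2) that in \<open>force simp: abs_le_iff\<close>)+
    then have "\<bar>w s - w t\<bar> \<le> B * \<bar>s - t\<bar>" by simp
    also have "\<bar>s - t\<bar> = sqrt \<bar>s - t\<bar> * sqrt \<bar>s - t\<bar>" by simp
    also have "B * \<dots> \<le> B * (sqrt (2 * r) * sqrt \<bar>s - t\<bar>)"
      using r(2)[OF that(1)] r(2)[OF that(2)] \<open>B \<ge> 0\<close>
      by (intro mult_left_mono mult_right_mono) auto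
    also have "sqrt \<bar>s - t\<bar> = \<bar>s - t\<bar> powr (1/2)"
      by (simp add: powr_half_sqrt)
    finally show ?thesis by (simp add: mult.assoc)
  qed
  then show ?thesis unfolding holder_continuous_on_def by blast
qed

lemma powr_bound_tendsto_0:
  fixes f :: "real \<Rightarrow> real"
  assumes "0 < p" "0 < d" and f: "\<And>t. 0 < t \<Longrightarrow> t \<le> d \<Longrightarrow> 0 \<le> f t \<and> f t \<le> k * t powr p"
  shows "(f \<longlongrightarrow> 0) (at_right 0)"
proof (rule tendsto_sandwich[OF _ _ tendsto_const])
  have ev: "eventually (\<lambda>t. t \<in> {0<..<d}) (at_right 0)"
    using eventually_at_right_real[OF \<open>0 < d\<close>] .
  then show "eventually (\<lambda>t. 0 \<le> f t) (at_right 0)" "eventually (\<lambda>t. f t \<le> k * t powr p) (at_right 0)"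
    by (auto elim!: eventually_mono simp: f)
  have "((\<lambda>t. t powr p) \<longlongrightarrow> 0 powr p) (at_right 0)"
    using \<open>0 < p\<close> by (intro tendsto_powr2 tendsto_const tendsto_ident_at) (auto simp: eventually_at_filter)
  from tendsto_mult[OF tendsto_const[of k] this]
  show "((\<lambda>t. k * t powr p) \<longlongrightarrow> 0) (at_right 0)" by simp
qed

section \<open>The flux, its primitive and the kinetic energy\<close>

locale phi_laplacian =
  fixes \<phi> :: "real \<Rightarrow> real" and l m :: real
  assumes phi_differentiable: "t > 0 \<Longrightarrow> \<phi> differentiable (at t)"
    and phi_pos: "t > 0 \<Longrightarrow> 0 < \<phi> t"
    and l_gt_1: "1 < l"
    and flux_deriv_ge: "t > 0 \<Longrightarrow> (l - 1) * \<phi> t \<le> deriv (\<lambda>s. \<phi> s * s) t"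
    and flux_deriv_le: "t > 0 \<Longrightarrow> deriv (\<lambda>s. \<phi> s * s) t \<le> (m - 1) * \<phi> t"
    and flux_at_0: "((\<lambda>t. \<phi> t * t) \<longlongrightarrow> 0) (at_right 0)"
begin

definition flux :: "real \<Rightarrow> real"
  where "flux s = \<phi> \<bar>s\<bar> * s"

definition dflux :: "real \<Rightarrow> real"
  where "dflux = deriv (\<lambda>s. \<phi> s * s)"

lemma m_gt_1: "1 < m"
  using flux_deriv_ge[of 1] flux_deriv_le[of 1] phi_pos[of 1] l_gt_1
  by (smt (verit) mult_right_le_imp_le)

lemma flux_0 [simp]: "flux 0 = 0"
  by (simp add: flux_def)

lemma flux_minus [simp]: "flux (- s) = - flux s"
  by (simp add: flux_def)

lemma flux_pos: "s > 0 \<Longrightarrow> flux s > 0"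
  by (simp add: flux_def phi_pos)

lemma dflux_pos: "s > 0 \<Longrightarrow> dflux s > 0"
  using flux_deriv_ge[of s] phi_pos[of s] l_gt_1 unfolding dflux_def
  by (smt (verit) mult_pos_pos)

lemma flux_has_derivative:
  assumes "s > 0"
  shows "(flux has_real_derivative dflux s) (at s)"
proof -
  have "(\<lambda>s. \<phi> s * s) differentiable (at s)"
    by (intro differentiable_mult phi_differentiable assms differentiable_ident)
  then have "((\<lambda>s. \<phi> s * s) has_real_derivative dflux s) (at s)"
    by (simp add: dflux_def DERIV_deriv_iff_real_differentiable)
  then show ?thesis
    by (rule has_field_derivative_transform_within_open[of _ _ _ "{0<..}"])
       (use assms in \<open>auto simp: flux_def\<close>)
qed

lemma flux_isCont: "isCont flux s"
proof -
  have pos: "isCont flux s" if "s > 0" for s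
    using flux_has_derivative[OF that] DERIV_isCont by blast
  have right0: "(flux \<longlongrightarrow> 0) (at_right 0)"
    by (rule Lim_transform_eventually[OF flux_at_0])
       (auto simp: eventually_at_filter flux_def)
  have left0: "(flux \<longlongrightarrow> 0) (at_left 0)"
    using tendsto_minus[OF right0] by (simp add: filterlim_at_left_to_right)
  have zero: "isCont flux 0"
    using left0 right0 by (simp add: isCont_def filterlim_at_split)
  have neg: "isCont flux s" if "s < 0"
  proof -
    have "isCont (\<lambda>s. - flux (- s)) s"
      using that pos[of "- s"]
      by (intro isCont_minus isCont_o2[where g = flux and f = uminus] continuous_ident) auto
    then show ?thesis by simp
  qed
  show ?thesis using pos zero neg by (cases s "0 :: real" rule: linorder_cases) auto
qed

lemma flux_continuous_on [continuous_intros]: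
  "continuous_on A f \<Longrightarrow> continuous_on A (\<lambda>x. flux (f x))"
  by (rule continuous_on_compose2[of UNIV flux])
     (auto simp: flux_isCont continuous_at_imp_continuous_on)

lemma flux_strict_mono: "strict_mono flux"
proof -
  have nonneg: "flux r < flux s" if "0 \<le> r" "r < s" for r s
  proof (rule DERIV_pos_imp_increasing_open[OF that(2)])
    fix x assume "r < x"
    then have "x > 0" using that by simp
    then show "\<exists>y. (flux has_real_derivative y) (at x) \<and> 0 < y"
      using flux_has_derivative dflux_pos by blast
  qed (intro continuous_intros)
  show ?thesis
  proof (rule strict_monoI)
    fix r s :: real assume "r < s"
    consider "0 \<le> r" | "s \<le> 0" | "r < 0" "0 < s" by linarith
    then show "flux r < flux s"
    proof cases
      case 2
      then show ?thesis using nonneg[of "- s" "- r"] \<open>r < s\<close> by simp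
    next
      case 3
      then show ?thesis using flux_pos[of s] flux_pos[of "- r"] by simp
    qed (use nonneg \<open>r < s\<close> in auto)
  qed
qed

text \<open>
  Since \<open>Phi\<close> is an integral over \<open>{0..\<bar>s\<bar>}\<close>, the fundamental theorem applies to it directly
  only for \<open>s \<ge> 0\<close>, and one-sidedly at \<open>0\<close>.  A primitive \<open>F\<close> of the odd function \<open>flux\<close> on
  the whole line is even, hence coincides with \<open>Phi\<close> up to a constant everywhere.
\<close>

lemma Phi_has_derivative: "(Phi \<phi> has_real_derivative flux s) (at s)"
proof -
  obtain F where "\<And>x. (F has_vector_derivative flux x) (at x)"
    using einterval_antiderivative[of "- \<infinity>" \<infinity> flux] flux_isCont by auto
  then have F: "(F has_real_derivative flux x) (at x)" for x
    by (simp add: has_real_derivative_iff_has_vector_derivative)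
  have nonneg: "Phi \<phi> x = F x - F 0" if "x \<ge> 0" for x
  proof -
    have "(flux has_integral F x - F 0) {0..x}"
      using that F
      by (intro fundamental_theorem_of_calculus)
         (auto simp: has_real_derivative_iff_has_vector_derivative[symmetric]
               intro: has_field_derivative_at_within)
    then have "((\<lambda>s. s * \<phi> s) has_integral F x - F 0) {0..x}"
      by (rule has_integral_eq[rotated]) (auto simp: flux_def)
    then show ?thesis using that by (simp add: Phi_def integral_unique)
  qed
  have even: "F (- x) = F x" for x
  proof -
    have "((\<lambda>x. F (- x) - F x) has_real_derivative 0) (at x)" for x
    proof -
      have "((\<lambda>x. F (- x)) has_real_derivative flux (- x) * (- 1)) (at x)"
        by (rule DERIV_chain2[where f = F and g = uminus, OF F]) (auto intro!: derivative_eq_intros)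
      from DERIV_diff[OF this F[of x]] show ?thesis by simp
    qed
    then have "F (- x) - F x = F (- 0) - F 0"
      by (intro DERIV_isconst_all) blast
    then show ?thesis by simp
  qed
  have "Phi \<phi> x = F x - F 0" for x
  proof (cases "x \<ge> 0")
    case False
    have "Phi \<phi> x = Phi \<phi> (- x)" by (simp add: Phi_def)
    then show ?thesis using nonneg[of "- x"] even[of x] False by simp
  qed (rule nonneg)
  then have "Phi \<phi> = (\<lambda>x. F x - F 0)" by auto
  then show ?thesis using F by (auto intro!: derivative_eq_intros)
qed

lemma Phi_0 [simp]: "Phi \<phi> 0 = 0"
  by (simp add: Phi_def)

lemma Phi_abs [simp]: "Phi \<phi> \<bar>s\<bar> = Phi \<phi> s"
  by (simp add: Phi_def)

lemma Phi_continuous_on [continuous_intros]: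
  "continuous_on A f \<Longrightarrow> continuous_on A (\<lambda>x. Phi \<phi> (f x))"
  by (rule continuous_on_compose2[of UNIV "Phi \<phi>"])
     (auto intro!: continuous_at_imp_continuous_on DERIV_isCont Phi_has_derivative)

lemma Phi_convex: "convex_on UNIV (Phi \<phi>)"
  by (rule convex_on_realI[of _ _ flux])
     (use Phi_has_derivative flux_strict_mono in \<open>auto simp: strict_mono_less_eq\<close>)

lemma Phi_above_tangent: "flux s * (r - s) \<le> Phi \<phi> r - Phi \<phi> s"
  by (rule convex_on_imp_above_tangent[OF Phi_convex]) (auto simp: Phi_has_derivative)

lemma Phi_pos:
  assumes "s > 0"
  shows "Phi \<phi> s > 0"
proof -
  have "flux (s / 2) * (s / 2) \<le> Phi \<phi> s - Phi \<phi> (s / 2)"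
    using Phi_above_tangent[of "s / 2" s] by simp
  moreover have "0 \<le> Phi \<phi> (s / 2)"
    using Phi_above_tangent[of 0 "s / 2"] by simp
  moreover have "0 < flux (s / 2) * (s / 2)"
    using assms flux_pos[of "s / 2"] by simp
  ultimately show ?thesis by linarith
qed

lemma Phi_scale_le:
  assumes "0 \<le> k" "k \<le> 1"
  shows "Phi \<phi> (k * s) \<le> k * Phi \<phi> s"
  using convex_onD[OF Phi_convex assms, of 0 s] by simp

lemma Phi_scale_ge:
  assumes "1 \<le> k"
  shows "k * Phi \<phi> s \<le> Phi \<phi> (k * s)"
  using Phi_scale_le[of "1 / k" "k * s"] assms by (simp add: field_simps)

text \<open>
  The Legendre transform of \<open>Phi \<phi>\<close> at the point \<open>flux s\<close>, as a function of \<open>s\<close>; it equals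
  \<open>s\<^sup>2 / 2\<close> for the Laplacian \<open>\<phi> = 1\<close>.
\<close>

definition kinetic :: "real \<Rightarrow> real"
  where "kinetic s = flux s * s - Phi \<phi> s"

lemma kinetic_0 [simp]: "kinetic 0 = 0"
  by (simp add: kinetic_def)

lemma kinetic_minus [simp]: "kinetic (- s) = kinetic s"
  using Phi_abs[of "- s"] Phi_abs[of s] by (simp add: kinetic_def)

lemma kinetic_abs [simp]: "kinetic \<bar>s\<bar> = kinetic s"
  by (simp add: abs_if)

lemma kinetic_continuous_on [continuous_intros]:
  "continuous_on A f \<Longrightarrow> continuous_on A (\<lambda>x. kinetic (f x))"
  unfolding kinetic_def by (intro continuous_intros)

lemma kinetic_has_derivative:
  assumes "s > 0"
  shows "(kinetic has_real_derivative s * dflux s) (at s)"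
  unfolding kinetic_def
  by (auto intro!: derivative_eq_intros flux_has_derivative Phi_has_derivative assms)

lemma kinetic_strict_mono_on: "strict_mono_on {0..} kinetic"
proof (rule strict_mono_onI)
  fix r s :: real assume "r \<in> {0..}" "r < s"
  show "kinetic r < kinetic s"
  proof (rule DERIV_pos_imp_increasing_open[OF \<open>r < s\<close>])
    fix x assume "r < x"
    then have "x > 0" using \<open>r \<in> {0..}\<close> by simp
    then show "\<exists>y. (kinetic has_real_derivative y) (at x) \<and> 0 < y"
      using kinetic_has_derivative dflux_pos mult_pos_pos by blast
  qed (intro continuous_intros)
qed

lemma kinetic_less_iff: "0 \<le> r \<Longrightarrow> 0 \<le> s \<Longrightarrow> kinetic r < kinetic s \<longleftrightarrow> r < s"
  using strict_mono_on_less[OF kinetic_strict_mono_on] by auto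

lemma kinetic_le_iff: "0 \<le> r \<Longrightarrow> 0 \<le> s \<Longrightarrow> kinetic r \<le> kinetic s \<longleftrightarrow> r \<le> s"
  using strict_mono_on_less_eq[OF kinetic_strict_mono_on] by auto

text \<open>
  Both sides vanish at \<open>0\<close>, and their derivatives \<open>(l - 1) * flux s\<close> and \<open>s * dflux s\<close> are
  ordered by the ellipticity bound.  The upper bound below has the same proof.
\<close>

lemma kinetic_ge:
  assumes "s \<ge> 0"
  shows "(l - 1) * Phi \<phi> s \<le> kinetic s"
proof -
  have "kinetic 0 - (l - 1) * Phi \<phi> 0 \<le> kinetic s - (l - 1) * Phi \<phi> s"
  proof (rule DERIV_nonneg_imp_increasing_open[OF assms])
    fix x :: real assume x: "0 < x"
    have "((\<lambda>s. kinetic s - (l - 1) * Phi \<phi> s) has_real_derivative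
        x * dflux x - (l - 1) * flux x) (at x)"
      by (auto intro!: derivative_eq_intros kinetic_has_derivative Phi_has_derivative x)
    moreover have "0 \<le> x * dflux x - (l - 1) * flux x"
      using mult_left_mono[OF flux_deriv_ge[OF x], of x] x
      by (simp add: dflux_def flux_def algebra_simps)
    ultimately show "\<exists>y. ((\<lambda>s. kinetic s - (l - 1) * Phi \<phi> s) has_real_derivative y) (at x) \<and> 0 \<le> y"
      by blast
  qed (intro continuous_intros)
  then show ?thesis by simp
qed

lemma kinetic_le:
  assumes "s \<ge> 0"
  shows "kinetic s \<le> (m - 1) * Phi \<phi> s"
proof -
  have "(m - 1) * Phi \<phi> 0 - kinetic 0 \<le> (m - 1) * Phi \<phi> s - kinetic s"
  proof (rule DERIV_nonneg_imp_increasing_open[OF assms])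
    fix x :: real assume x: "0 < x"
    have "((\<lambda>s. (m - 1) * Phi \<phi> s - kinetic s) has_real_derivative
        (m - 1) * flux x - x * dflux x) (at x)"
      by (auto intro!: derivative_eq_intros kinetic_has_derivative Phi_has_derivative x)
    moreover have "0 \<le> (m - 1) * flux x - x * dflux x"
      using mult_left_mono[OF flux_deriv_le[OF x], of x] x
      by (simp add: dflux_def flux_def algebra_simps)
    ultimately show "\<exists>y. ((\<lambda>s. (m - 1) * Phi \<phi> s - kinetic s) has_real_derivative y) (at x) \<and> 0 \<le> y"
      by blast
  qed (intro continuous_intros)
  then show ?thesis by simp
qed

lemma ex_kinetic_eq:
  assumes "y > 0"
  shows "\<exists>s>0. kinetic s = y"
proof -
  define k where "k = max 1 (y / ((l - 1) * Phi \<phi> 1))"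
  have p: "(l - 1) * Phi \<phi> 1 > 0" using Phi_pos[of 1] l_gt_1 by simp
  have "y \<le> k * ((l - 1) * Phi \<phi> 1)"
    using p by (simp add: k_def max_def field_simps)
  also have "\<dots> \<le> (l - 1) * Phi \<phi> (k * 1)"
    using mult_left_mono[OF Phi_scale_ge[of k 1], of "l - 1"] l_gt_1
    by (simp add: k_def algebra_simps)
  also have "\<dots> \<le> kinetic k" using kinetic_ge[of k] by (simp add: k_def)
  finally have "y \<le> kinetic k" .
  moreover have "0 \<le> k" by (simp add: k_def)
  ultimately obtain s where "0 \<le> s" "kinetic s = y"
    using IVT'[of kinetic 0 y k] assms kinetic_continuous_on[OF continuous_on_id] by auto
  then show ?thesis using assms by (intro exI[of _ s]) (auto simp: le_less)
qed

definition speed :: "real \<Rightarrow> real"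
  where "speed y = (SOME s. 0 < s \<and> kinetic s = y)"

lemma
  assumes "y > 0"
  shows speed_pos: "speed y > 0" and kinetic_speed: "kinetic (speed y) = y"
  using someI_ex[OF ex_kinetic_eq[OF assms]] unfolding speed_def by auto

lemma speed_isCont:
  assumes "y > 0"
  shows "isCont speed y"
  unfolding isCont_def
proof (rule tendsto_if_strict_mono_image_tendsto)
  show "strict_mono_on {0<..} kinetic"
    using kinetic_strict_mono_on by (auto simp: strict_mono_on_def)
  have ev: "eventually (\<lambda>x. x > 0) (at y)"
    using assms by (intro order_tendstoD(1)[of _ y] tendsto_ident_at)
  then show "eventually (\<lambda>x. speed x \<in> {0<..}) (at y)"
    by eventually_elim (simp add: speed_pos)
  have "eventually (\<lambda>x. x = kinetic (speed x)) (at y)"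
    using ev by eventually_elim (simp add: kinetic_speed)
  then show "((\<lambda>x. kinetic (speed x)) \<longlongrightarrow> kinetic (speed y)) (at y)"
    using assms by (simp add: kinetic_speed) (rule Lim_transform_eventually[OF tendsto_ident_at])
qed (use assms speed_pos in auto)

lemma speed_has_derivative:
  assumes "y > 0"
  shows "(speed has_real_derivative inverse (speed y * dflux (speed y))) (at y)"
  by (rule DERIV_inverse_function[where f = kinetic and a = 0 and b = "y + 1"])
     (use assms speed_pos[OF assms] dflux_pos[OF speed_pos[OF assms]] in
       \<open>auto intro!: kinetic_has_derivative speed_isCont simp: kinetic_speed\<close>)

text \<open>
  This replaces the chain rule for \<open>kinetic \<circ> w\<close> when only \<open>flux \<circ> w\<close> is known to be
  differentiable: \<open>w\<close> itself need not be, since \<open>dflux\<close> may vanish at \<open>0\<close>.  The Legendre transform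
  of \<open>Phi\<close> has derivative \<open>s\<close> at \<open>flux s\<close>, including \<open>s = 0\<close>; quantitatively, the tangent
  inequality for \<open>Phi\<close>, used at both points, bounds
  \<open>kinetic b - kinetic a - a * (flux b - flux a)\<close> by \<open>\<bar>b - a\<bar> * \<bar>flux b - flux a\<bar>\<close>, and \<open>w\<close>
  is continuous.
\<close>

lemma
  assumes "((\<lambda>s. flux (w s)) has_real_derivative d) (at t)"
  shows isCont_if_flux_differentiable: "isCont w t"
    and kinetic_has_derivative_along: "((\<lambda>s. kinetic (w s)) has_real_derivative w t * d) (at t)"
proof -
  have "((\<lambda>s. flux (w s)) \<longlongrightarrow> flux (w t)) (at t)"
    using DERIV_isCont[OF assms] by (simp add: isCont_def)
  then have w: "(w \<longlongrightarrow> w t) (at t)"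
    by (rule tendsto_if_strict_mono_image_tendsto[OF flux_strict_mono open_UNIV UNIV_I, rotated])
      simp
  then show "isCont w t" by (simp add: isCont_def)
  have est: "\<bar>kinetic b - kinetic a - a * (flux b - flux a)\<bar> \<le> \<bar>b - a\<bar> * \<bar>flux b - flux a\<bar>"
    for a b
  proof -
    have "kinetic b - kinetic a - a * (flux b - flux a) = flux b * (b - a) - (Phi \<phi> b - Phi \<phi> a)"
      by (simp add: kinetic_def algebra_simps)
    moreover have "Phi \<phi> b - Phi \<phi> a \<le> flux b * (b - a)"
      using Phi_above_tangent[of b a] by (simp add: algebra_simps)
    moreover have "flux b * (b - a) - (Phi \<phi> b - Phi \<phi> a) \<le> (b - a) * (flux b - flux a)"
      using Phi_above_tangent[of a b] by (simp add: algebra_simps)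
    ultimately show ?thesis by (simp add: abs_mult[symmetric])
  qed
  let ?Q = "\<lambda>y. (flux (w y) - flux (w t)) / (y - t)"
  let ?E = "\<lambda>y. (kinetic (w y) - kinetic (w t)) / (y - t)"
  have Q: "(?Q \<longlongrightarrow> d) (at t)"
    using assms by (simp add: has_field_derivative_iff)
  have "((\<lambda>y. ?E y - w t * ?Q y) \<longlongrightarrow> 0) (at t)"
  proof (rule Lim_null_comparison)
    have "((\<lambda>y. \<bar>w y - w t\<bar> * \<bar>?Q y\<bar>) \<longlongrightarrow> \<bar>w t - w t\<bar> * \<bar>d\<bar>) (at t)"
      by (intro tendsto_intros w Q)
    then show "((\<lambda>y. \<bar>w y - w t\<bar> * \<bar>?Q y\<bar>) \<longlongrightarrow> 0) (at t)" by simp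
    show "\<forall>\<^sub>F y in at t. norm (?E y - w t * ?Q y) \<le> \<bar>w y - w t\<bar> * \<bar>?Q y\<bar>"
    proof (rule eventuallyI)
      fix y
      have "?E y - w t * ?Q y =
          (kinetic (w y) - kinetic (w t) - w t * (flux (w y) - flux (w t))) / (y - t)"
        by (simp add: diff_divide_distrib right_diff_distrib)
      then have "norm (?E y - w t * ?Q y) =
          \<bar>kinetic (w y) - kinetic (w t) - w t * (flux (w y) - flux (w t))\<bar> / \<bar>y - t\<bar>"
        by (simp only: real_norm_def abs_divide)
      also have "\<dots> \<le> \<bar>w y - w t\<bar> * \<bar>flux (w y) - flux (w t)\<bar> / \<bar>y - t\<bar>"
        by (intro divide_right_mono est) auto
      finally show "norm (?E y - w t * ?Q y) \<le> \<bar>w y - w t\<bar> * \<bar>?Q y\<bar>"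
        by (simp add: abs_divide)
    qed
  qed
  from tendsto_add[OF this tendsto_mult[OF tendsto_const Q, of "w t"]]
  show "((\<lambda>s. kinetic (w s)) has_real_derivative w t * d) (at t)"
    by (simp add: has_field_derivative_iff)
qed

text \<open>
  Since \<open>Phi\<close> is convex and vanishes at \<open>0\<close>, a factor in front of \<open>Phi\<close> may be moved inside:
  a factor at most \<open>1\<close> in upper bounds, a factor at least \<open>1\<close> in lower bounds.  This explains the
  truncation at \<open>1\<close> of the constants in this lemma and the next.
\<close>

lemma kinetic_scaled_le_if_Phi_le:
  assumes "y \<ge> 0" "a > 0" "a * Phi \<phi> y \<le> z"
  shows "kinetic (min 1 (a / (m - 1)) * y) \<le> z"
proof -
  let ?k = "min 1 (a / (m - 1))"
  have k: "0 < ?k" "?k \<le> 1" "(m - 1) * ?k \<le> a"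
    using assms m_gt_1 by (auto simp: min_def field_simps)
  have Py: "Phi \<phi> y \<ge> 0" using Phi_pos[of y] assms(1) by (cases "y = 0") auto
  have "kinetic (?k * y) \<le> (m - 1) * Phi \<phi> (?k * y)"
    using k assms(1) by (intro kinetic_le) auto
  also have "\<dots> \<le> (m - 1) * (?k * Phi \<phi> y)"
    using k m_gt_1 by (intro mult_left_mono Phi_scale_le) auto
  also have "\<dots> \<le> a * Phi \<phi> y"
    using mult_right_mono[OF k(3) Py] by (simp add: mult.assoc)
  finally show ?thesis using assms(3) by simp
qed

lemma le_kinetic_scaled_if_le_Phi:
  assumes "y \<ge> 0" "b > 0" "z \<le> b * Phi \<phi> y"
  shows "z \<le> kinetic (max 1 (b / (l - 1)) * y)"
proof -
  let ?k = "max 1 (b / (l - 1))"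
  have k: "1 \<le> ?k" "b \<le> (l - 1) * ?k"
    using assms l_gt_1 by (auto simp: max_def field_simps)
  have Py: "Phi \<phi> y \<ge> 0" using Phi_pos[of y] assms(1) by (cases "y = 0") auto
  have "b * Phi \<phi> y \<le> (l - 1) * (?k * Phi \<phi> y)"
    using mult_right_mono[OF k(2) Py] by (simp add: mult.assoc)
  also have "\<dots> \<le> (l - 1) * Phi \<phi> (?k * y)"
    using k l_gt_1 by (intro mult_left_mono Phi_scale_ge) auto
  also have "\<dots> \<le> kinetic (?k * y)"
    using k assms(1) by (intro kinetic_ge) auto
  finally show ?thesis using assms(3) by simp
qed

text \<open>
  Near the wells \<open>\<alpha>\<^sup>2 - x\<^sup>2\<close> is comparable to the distance \<open>\<alpha> - \<bar>x\<bar>\<close>, namely between \<open>\<alpha>\<close>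
  and \<open>2 * \<alpha>\<close> times it, and the two preceding lemmas apply.  On the compact remaining interval \<open>V\<close>
  has a positive minimum and a maximum.  The weight \<open>\<alpha>\<^sup>2 - x\<^sup>2\<close> is preferred to the distance since
  the resulting comparison equation is solved by \<open>tanh\<close>, and since it is the one that occurs
  in the explicit potential.
\<close>

lemma ex_well_bounds:
  assumes "\<alpha> > 0" "0 < \<delta>" "\<delta> < \<alpha>" "a > 0" "b > 0"
    and V: "continuous_on UNIV V" and V_pos: "\<And>x. \<bar>x\<bar> < \<alpha> \<Longrightarrow> 0 < V x"
    and near: "\<And>x. \<alpha> - \<delta> < \<bar>x\<bar> \<Longrightarrow> \<bar>x\<bar> < \<alpha> \<Longrightarrow>
      a * Phi \<phi> (\<alpha> - \<bar>x\<bar>) \<le> V x \<and> V x \<le> b * Phi \<phi> (\<alpha> - \<bar>x\<bar>)"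
  shows "\<exists>c>0. \<exists>C>0. \<forall>x. \<bar>x\<bar> < \<alpha> \<longrightarrow>
    kinetic (c * (\<alpha>\<^sup>2 - x\<^sup>2)) \<le> V x \<and> V x \<le> kinetic (C * (\<alpha>\<^sup>2 - x\<^sup>2))"
proof -
  let ?K = "{- (\<alpha> - \<delta>)..\<alpha> - \<delta>}"
  have K: "compact ?K" "?K \<noteq> {}" "continuous_on ?K V"
    using assms by (auto intro: continuous_on_subset)
  obtain p where p: "p \<in> ?K" "\<And>x. x \<in> ?K \<Longrightarrow> V p \<le> V x"
    using continuous_attains_inf[OF K] by blast
  obtain r where r: "r \<in> ?K" "\<And>x. x \<in> ?K \<Longrightarrow> V x \<le> V r"
    using continuous_attains_sup[OF K] by blast
  have Vpr: "V p > 0" "V r > 0" using p(1) r(1) V_pos assms by (auto simp: abs_le_iff)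
  define d where "d = \<alpha>\<^sup>2 - (\<alpha> - \<delta>)\<^sup>2"
  have "d > 0" using assms unfolding d_def
    by (simp add: power_strict_mono)
  define c\<^sub>1 where "c\<^sub>1 = min 1 (a / (m - 1))"
  define C\<^sub>1 where "C\<^sub>1 = max 1 (b / (l - 1))"
  define c where "c = min (c\<^sub>1 / (2 * \<alpha>)) (speed (V p) / \<alpha>\<^sup>2)"
  define C where "C = max (C\<^sub>1 / \<alpha>) (speed (V r) / d)"
  have c1: "c\<^sub>1 > 0" "C\<^sub>1 > 0" using assms m_gt_1 by (auto simp: c\<^sub>1_def C\<^sub>1_def)
  have "c > 0" using c1 assms speed_pos[OF Vpr(1)] by (simp add: c_def)
  have "C > 0" using c1 assms by (simp add: C_def less_max_iff_disj)
  have "kinetic (c * (\<alpha>\<^sup>2 - x\<^sup>2)) \<le> V x \<and> V x \<le> kinetic (C * (\<alpha>\<^sup>2 - x\<^sup>2))" if x: "\<bar>x\<bar> < \<alpha>" for x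
  proof -
    have sq: "x\<^sup>2 < \<alpha>\<^sup>2" using x by (rule square_less_if_abs_less)
    have fact: "\<alpha>\<^sup>2 - x\<^sup>2 = (\<alpha> - \<bar>x\<bar>) * (\<alpha> + \<bar>x\<bar>)"
      by (simp add: algebra_simps power2_eq_square)
    show ?thesis
    proof (cases "\<alpha> - \<delta> < \<bar>x\<bar>")
      case True
      let ?y = "\<alpha> - \<bar>x\<bar>"
      have y: "?y \<ge> 0" using x by simp
      have "c * (\<alpha>\<^sup>2 - x\<^sup>2) \<le> c\<^sub>1 / (2 * \<alpha>) * (\<alpha>\<^sup>2 - x\<^sup>2)"
        using sq by (intro mult_right_mono) (auto simp: c_def)
      also have "\<dots> \<le> c\<^sub>1 / (2 * \<alpha>) * (?y * (2 * \<alpha>))"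
        unfolding fact using x c1 by (intro mult_left_mono) auto
      also have "\<dots> = c\<^sub>1 * ?y" using assms(1) by simp
      finally have lo: "c * (\<alpha>\<^sup>2 - x\<^sup>2) \<le> c\<^sub>1 * ?y" .
      have "C\<^sub>1 * ?y = C\<^sub>1 / \<alpha> * (?y * \<alpha>)" using assms(1) by simp
      also have "\<dots> \<le> C\<^sub>1 / \<alpha> * (\<alpha>\<^sup>2 - x\<^sup>2)"
        unfolding fact using x c1 by (intro mult_left_mono) auto
      also have "\<dots> \<le> C * (\<alpha>\<^sup>2 - x\<^sup>2)"
        using sq by (intro mult_right_mono) (auto simp: C_def)
      finally have hi: "C\<^sub>1 * ?y \<le> C * (\<alpha>\<^sup>2 - x\<^sup>2)" .
      have "kinetic (c * (\<alpha>\<^sup>2 - x\<^sup>2)) \<le> kinetic (c\<^sub>1 * ?y)"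
        using lo y c1 sq \<open>c > 0\<close> by (subst kinetic_le_iff) auto
      also have "\<dots> \<le> V x"
        using near[OF True x] y assms unfolding c\<^sub>1_def by (intro kinetic_scaled_le_if_Phi_le) auto
      finally have 1: "kinetic (c * (\<alpha>\<^sup>2 - x\<^sup>2)) \<le> V x" .
      have "V x \<le> kinetic (C\<^sub>1 * ?y)"
        using near[OF True x] y assms unfolding C\<^sub>1_def by (intro le_kinetic_scaled_if_le_Phi) auto
      also have "\<dots> \<le> kinetic (C * (\<alpha>\<^sup>2 - x\<^sup>2))"
        using hi y c1 sq \<open>C > 0\<close> by (subst kinetic_le_iff) auto
      finally show ?thesis using 1 by blast
    next
      case False
      then have xK: "x \<in> ?K" by (auto simp: abs_le_iff)
      have "c * (\<alpha>\<^sup>2 - x\<^sup>2) \<le> speed (V p) / \<alpha>\<^sup>2 * \<alpha>\<^sup>2"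
        using sq \<open>c > 0\<close> by (intro mult_mono) (auto simp: c_def intro: less_imp_le)
      also have "\<dots> = speed (V p)" using assms(1) by simp
      finally have "kinetic (c * (\<alpha>\<^sup>2 - x\<^sup>2)) \<le> kinetic (speed (V p))"
        using sq \<open>c > 0\<close> speed_pos[OF Vpr(1)] by (subst kinetic_le_iff) auto
      then have 1: "kinetic (c * (\<alpha>\<^sup>2 - x\<^sup>2)) \<le> V x"
        using p(2)[OF xK] kinetic_speed[OF Vpr(1)] by simp
      have "\<bar>x\<bar>\<^sup>2 \<le> (\<alpha> - \<delta>)\<^sup>2" using False by (intro power_mono) auto
      then have dx: "d \<le> \<alpha>\<^sup>2 - x\<^sup>2" by (simp add: d_def)
      have "speed (V r) = speed (V r) / d * d" using \<open>d > 0\<close> by simp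
      also have "\<dots> \<le> C * (\<alpha>\<^sup>2 - x\<^sup>2)"
        using dx \<open>d > 0\<close> \<open>C > 0\<close> by (intro mult_mono) (auto simp: C_def)
      finally have "kinetic (speed (V r)) \<le> kinetic (C * (\<alpha>\<^sup>2 - x\<^sup>2))"
        using sq \<open>C > 0\<close> speed_pos[OF Vpr(2)] by (subst kinetic_le_iff) auto
      then show ?thesis using 1 r(2)[OF xK] kinetic_speed[OF Vpr(2)] by simp
    qed
  qed
  then show ?thesis using \<open>c > 0\<close> \<open>C > 0\<close> by blast
qed

end

section \<open>Reduction to a first-order equation, and its unique solution\<close>

text \<open>
  The constants \<open>c\<close> and \<open>C\<close> are parameters because they end up as the rates of the comparison
  functions: for a general potential they come from \<open>ex_well_bounds\<close>, for the explicit potential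
  they have explicit values.
\<close>

locale double_well = phi_laplacian +
  fixes V :: "real \<Rightarrow> real" and \<alpha> c C :: real
  assumes alpha_pos: "0 < \<alpha>"
    and V_C1: "V C1_differentiable_on UNIV"
    and V_right: "V \<alpha> = 0"
    and V_pos: "\<bar>x\<bar> < \<alpha> \<Longrightarrow> 0 < V x"
    and c_pos: "0 < c" and C_pos: "0 < C"
    and V_ge: "\<bar>x\<bar> < \<alpha> \<Longrightarrow> kinetic (c * (\<alpha>\<^sup>2 - x\<^sup>2)) \<le> V x"
    and V_le: "\<bar>x\<bar> < \<alpha> \<Longrightarrow> V x \<le> kinetic (C * (\<alpha>\<^sup>2 - x\<^sup>2))"
begin

text \<open>
  The speed at which a solution of zero energy passes the point \<open>x\<close>.
\<close>

definition passage_speed :: "real \<Rightarrow> real"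
  where "passage_speed x = speed (V x)"

lemma passage_speed_pos: "\<bar>x\<bar> < \<alpha> \<Longrightarrow> 0 < passage_speed x"
  by (simp add: passage_speed_def speed_pos V_pos)

lemma kinetic_passage_speed: "\<bar>x\<bar> < \<alpha> \<Longrightarrow> kinetic (passage_speed x) = V x"
  by (simp add: passage_speed_def kinetic_speed V_pos)

lemma passage_speed_ge:
  assumes "\<bar>x\<bar> < \<alpha>"
  shows "c * (\<alpha>\<^sup>2 - x\<^sup>2) \<le> passage_speed x"
  using V_ge[OF assms] kinetic_passage_speed[OF assms] passage_speed_pos[OF assms] c_pos square_less_if_abs_less[OF assms]
  by (subst kinetic_le_iff[symmetric]) auto

lemma passage_speed_le:
  assumes "\<bar>x\<bar> < \<alpha>"
  shows "passage_speed x \<le> C * (\<alpha>\<^sup>2 - x\<^sup>2)"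
  using V_le[OF assms] kinetic_passage_speed[OF assms] passage_speed_pos[OF assms] C_pos square_less_if_abs_less[OF assms]
  by (subst kinetic_le_iff[symmetric]) auto

lemma V_has_derivative: "(V has_real_derivative deriv V x) (at x)"
  using V_C1 unfolding C1_differentiable_on_eq by (simp add: DERIV_deriv_iff_real_differentiable)

lemma deriv_V_continuous_on: "continuous_on A (deriv V)"
proof -
  have "vector_derivative V (at x) = deriv V x" for x
    using V_has_derivative
    by (intro vector_derivative_at) (simp add: has_real_derivative_iff_has_vector_derivative)
  then have "continuous_on UNIV (deriv V)"
    using V_C1 unfolding C1_differentiable_on_eq by simp
  then show ?thesis by (rule continuous_on_subset) simp
qed

lemma passage_speed_has_derivative:
  assumes "\<bar>x\<bar> < \<alpha>"
  shows "(passage_speed has_real_derivative deriv V x / (passage_speed x * dflux (passage_speed x))) (at x)"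
proof -
  have "((\<lambda>x. speed (V x)) has_real_derivative
      inverse (speed (V x) * dflux (speed (V x))) * deriv V x) (at x)"
    by (rule DERIV_chain2[where f = speed, OF speed_has_derivative[OF V_pos[OF assms]] V_has_derivative])
  then show ?thesis by (simp add: passage_speed_def[abs_def] field_simps)
qed

text \<open>
  The first-order form of the problem; the limits at infinity are a consequence of it.
\<close>

definition transition :: "(real \<Rightarrow> real) \<Rightarrow> bool"
  where "transition u \<longleftrightarrow> u 0 = 0 \<and>
    (\<forall>t. \<bar>u t\<bar> < \<alpha> \<and> (u has_real_derivative passage_speed (u t)) (at t))"

lemma flux_equation:
  assumes "heteroclinic_solution \<phi> V \<alpha> u"
  shows "((\<lambda>s. flux (deriv u s)) has_real_derivative deriv V (u t)) (at t)"
proof -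
  have "(\<lambda>s. flux (deriv u s)) differentiable (at t)"
    and "- deriv (\<lambda>s. flux (deriv u s)) t + deriv V (u t) = 0"
    using assms by (simp_all add: heteroclinic_solution_def flux_def)
  then show ?thesis by (simp add: DERIV_deriv_iff_real_differentiable[symmetric])
qed

text \<open>
  The energy is constant, and its value is the limit of \<open>kinetic (u')\<close> at \<open>\<infinity>\<close>.  If this were
  positive, \<open>\<bar>u'\<bar>\<close> would eventually exceed some \<open>s\<^sub>0 > 0\<close>, so that \<open>u\<close> would change by more than \<open>s\<^sub>0\<close>
  on each unit interval far out, contrary to its convergence.
\<close>

lemma zero_energy:
  assumes "heteroclinic_solution \<phi> V \<alpha> u"
  shows "kinetic (deriv u t) = V (u t)"
proof -
  have u: "(u has_real_derivative deriv u s) (at s)" for s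
    using assms by (simp add: heteroclinic_solution_def DERIV_deriv_iff_real_differentiable)
  have "((\<lambda>s. kinetic (deriv u s) - V (u s)) has_real_derivative 0) (at s)" for s
  proof -
    have "((\<lambda>s. V (u s)) has_real_derivative deriv V (u s) * deriv u s) (at s)"
      by (rule DERIV_chain2[where f = V, OF V_has_derivative u])
    from DERIV_diff[OF kinetic_has_derivative_along[OF flux_equation[OF assms]] this] show ?thesis by simp
  qed
  then have const: "kinetic (deriv u s) - V (u s) = kinetic (deriv u t) - V (u t)" for s
    by (intro DERIV_isconst_all) blast
  define e where "e = kinetic (deriv u t) - V (u t)"
  have lim_u: "(u \<longlongrightarrow> \<alpha>) at_top" using assms by (simp add: heteroclinic_solution_def)
  have "isCont V \<alpha>" using V_has_derivative DERIV_isCont by blast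
  from isCont_tendsto_compose[OF this lim_u] have "((\<lambda>s. V (u s)) \<longlongrightarrow> 0) at_top"
    by (simp add: V_right)
  moreover have "V (u s) + e = kinetic (deriv u s)" for s
    using const[of s] by (simp add: e_def)
  ultimately have lim: "((\<lambda>s. kinetic (deriv u s)) \<longlongrightarrow> e) at_top"
    using tendsto_add[OF _ tendsto_const[of e], of "\<lambda>s. V (u s)" 0 at_top] by simp
  have nonneg: "0 \<le> kinetic s" for s
    using kinetic_le_iff[of 0 "\<bar>s\<bar>"] by simp
  have "0 \<le> e" by (rule tendsto_lowerbound[OF lim]) (simp_all add: nonneg)
  moreover have "\<not> 0 < e"
  proof
    assume "0 < e"
    define s\<^sub>0 where "s\<^sub>0 = speed (e / 2)"
    have s0: "s\<^sub>0 > 0" "kinetic s\<^sub>0 = e / 2"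
      using \<open>0 < e\<close> by (auto simp: s\<^sub>0_def speed_pos kinetic_speed)
    have "eventually (\<lambda>s. e / 2 < kinetic (deriv u s)) at_top"
      using lim \<open>0 < e\<close> by (intro order_tendstoD(1)) auto
    moreover have "eventually (\<lambda>s. \<bar>u s - \<alpha>\<bar> < s\<^sub>0 / 2) at_top"
      using tendstoD[OF lim_u, of "s\<^sub>0 / 2"] s0 by (simp add: dist_real_def)
    ultimately have "eventually (\<lambda>s. e / 2 < kinetic (deriv u s) \<and> \<bar>u s - \<alpha>\<bar> < s\<^sub>0 / 2) at_top"
      by eventually_elim auto
    then obtain N where N: "\<And>s. s \<ge> N \<Longrightarrow> e / 2 < kinetic (deriv u s)"
      "\<And>s. s \<ge> N \<Longrightarrow> \<bar>u s - \<alpha>\<bar> < s\<^sub>0 / 2"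
      unfolding eventually_at_top_linorder by blast
    obtain z where z: "z > N" "u (N + 1) - u N = (N + 1 - N) * deriv u z"
      using MVT2[of N "N + 1" u "deriv u"] u by auto
    have "s\<^sub>0 < \<bar>deriv u z\<bar>"
      using N(1)[of z] z(1) s0 by (subst kinetic_less_iff[symmetric]) auto
    moreover have "\<bar>u (N + 1) - u N\<bar> < s\<^sub>0"
      using N(2)[of N] N(2)[of "N + 1"] by linarith
    ultimately show False using z(2) by simp
  qed
  ultimately show ?thesis by (simp add: e_def)
qed

text \<open>
  Zero energy fixes \<open>\<bar>u'\<bar>\<close> as long as \<open>\<bar>u\<bar> < \<alpha>\<close>, which the barrier guarantees for all time.
  Then \<open>u'\<close> is continuous without zeros, and it is positive somewhere since \<open>u\<close> starts at \<open>0\<close> and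
  tends to \<open>\<alpha> > 0\<close>.
\<close>

lemma transition_if_heteroclinic:
  assumes "heteroclinic_solution \<phi> V \<alpha> u"
  shows "transition u"
proof -
  have u: "(u has_real_derivative deriv u s) (at s)" for s
    using assms by (simp add: heteroclinic_solution_def DERIV_deriv_iff_real_differentiable)
  have u0: "u 0 = 0" using assms by (simp add: heteroclinic_solution_def)
  have abs_deriv: "\<bar>deriv u s\<bar> = passage_speed (u s)" if "\<bar>u s\<bar> < \<alpha>" for s
  proof -
    have "kinetic \<bar>deriv u s\<bar> = kinetic (passage_speed (u s))"
      using zero_energy[OF assms, of s] kinetic_passage_speed[OF that] by simp
    then show ?thesis
      using kinetic_le_iff[of "\<bar>deriv u s\<bar>" "passage_speed (u s)"] kinetic_le_iff[of "passage_speed (u s)" "\<bar>deriv u s\<bar>"]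
        passage_speed_pos[OF that] by simp
  qed
  have bound: "\<bar>u s\<bar> < \<alpha>" for s
  proof (rule barrier[OF alpha_pos u0 u])
    fix s assume "\<bar>u s\<bar> < \<alpha>"
    then show "\<bar>deriv u s\<bar> \<le> C * (\<alpha>\<^sup>2 - (u s)\<^sup>2)" using abs_deriv passage_speed_le by simp
  qed
  have nz: "deriv u s \<noteq> 0" for s
    using abs_deriv[OF bound, of s] passage_speed_pos[OF bound, of s] by auto
  have "isCont (deriv u) s" for s
    by (rule isCont_if_flux_differentiable[OF flux_equation[OF assms]])
  then have cont: "continuous_on A (deriv u)" for A
    by (simp add: continuous_at_imp_continuous_on)
  obtain z where z: "deriv u z > 0"
  proof -
    have "eventually (\<lambda>s. 0 < u s) at_top"
      using assms alpha_pos unfolding heteroclinic_solution_def by (intro order_tendstoD(1)) auto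
    then obtain N where "\<And>s. s \<ge> N \<Longrightarrow> 0 < u s"
      unfolding eventually_at_top_linorder by blast
    then have "0 < u (max N 1)" by simp
    moreover have "\<exists>z>0. z < max N 1 \<and> u (max N 1) - u 0 = (max N 1 - 0) * deriv u z"
      by (rule MVT2) (auto intro: u)
    then obtain z where "u (max N 1) - u 0 = (max N 1 - 0) * deriv u z" by blast
    ultimately have "0 < max N 1 * deriv u z" using u0 by simp
    then have "0 < deriv u z" by (simp add: zero_less_mult_iff)
    then show ?thesis by (rule that)
  qed
  have "deriv u s > 0" for s
  proof (rule ccontr)
    assume "\<not> 0 < deriv u s"
    then have "\<exists>r. deriv u r = 0"
      using IVT'[of "deriv u" s 0 z] IVT2'[of "deriv u" s 0 z] cont z by (cases "s \<le> z") auto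
    then show False using nz by blast
  qed
  then have "deriv u s = passage_speed (u s)" for s
    using abs_deriv[OF bound, of s] by (simp add: abs_of_pos)
  then show ?thesis using u u0 bound by (simp add: transition_def)
qed

lemma ex_travel_time:
  "\<exists>T. T 0 = 0 \<and> (\<forall>x. \<bar>x\<bar> < \<alpha> \<longrightarrow> (T has_real_derivative 1 / passage_speed x) (at x))"
proof -
  have "isCont (\<lambda>x. 1 / passage_speed x) x" if "\<bar>x\<bar> < \<alpha>" for x
    using passage_speed_has_derivative[OF that] passage_speed_pos[OF that]
    by (intro continuous_intros) (auto intro: DERIV_isCont)
  then obtain F where F: "\<forall>x. ereal (- \<alpha>) < ereal x \<longrightarrow> ereal x < ereal \<alpha> \<longrightarrow>
      (F has_vector_derivative 1 / passage_speed x) (at x)"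
    using einterval_antiderivative[of "ereal (- \<alpha>)" "ereal \<alpha>" "\<lambda>x. 1 / passage_speed x"] alpha_pos
    by (auto simp: abs_less_iff minus_less_iff)
  have "(F has_vector_derivative 1 / passage_speed x) (at x)" if "\<bar>x\<bar> < \<alpha>" for x
    using F that by (auto simp: abs_less_iff minus_less_iff)
  then have "\<bar>x\<bar> < \<alpha> \<Longrightarrow> ((\<lambda>x. F x - F 0) has_real_derivative 1 / passage_speed x) (at x)" for x
    by (auto simp: has_real_derivative_iff_has_vector_derivative[symmetric]
        intro!: derivative_eq_intros)
  then show ?thesis by (intro exI[of _ "\<lambda>x. F x - F 0"]) auto
qed

definition travel_time :: "real \<Rightarrow> real"
  where "travel_time = (SOME T. T 0 = 0 \<and>
    (\<forall>x. \<bar>x\<bar> < \<alpha> \<longrightarrow> (T has_real_derivative 1 / passage_speed x) (at x)))"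

lemma travel_time_0 [simp]: "travel_time 0 = 0"
  and travel_time_has_derivative:
    "\<bar>x\<bar> < \<alpha> \<Longrightarrow> (travel_time has_real_derivative 1 / passage_speed x) (at x)"
  using someI_ex[OF ex_travel_time] unfolding travel_time_def by auto

lemma travel_time_strict_mono: "strict_mono_on {- \<alpha><..<\<alpha>} travel_time"
proof (rule strict_mono_onI)
  fix r s assume rs: "r \<in> {- \<alpha><..<\<alpha>}" "s \<in> {- \<alpha><..<\<alpha>}" "r < s"
  show "travel_time r < travel_time s"
  proof (rule DERIV_pos_imp_increasing[OF rs(3)])
    fix x assume "r \<le> x" "x \<le> s"
    then have "\<bar>x\<bar> < \<alpha>" using rs by auto
    then show "\<exists>y. (travel_time has_real_derivative y) (at x) \<and> 0 < y"
      using travel_time_has_derivative passage_speed_pos by (metis zero_less_divide_1_iff)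
  qed
qed

text \<open>
  Separation of variables.
\<close>

lemma travel_time_transition:
  assumes "transition u"
  shows "travel_time (u t) = t"
proof -
  have "((\<lambda>t. travel_time (u t) - t) has_real_derivative 0) (at t)" for t
  proof -
    have u: "\<bar>u t\<bar> < \<alpha>" "(u has_real_derivative passage_speed (u t)) (at t)"
      using assms by (auto simp: transition_def)
    have "((\<lambda>t. travel_time (u t)) has_real_derivative 1 / passage_speed (u t) * passage_speed (u t)) (at t)"
      by (rule DERIV_chain2[where f = travel_time, OF travel_time_has_derivative[OF u(1)] u(2)])
    from DERIV_diff[OF this DERIV_ident] show ?thesis using passage_speed_pos[OF u(1)] by simp
  qed
  then have "travel_time (u t) - t = travel_time (u 0) - 0"
    by (intro DERIV_isconst_all) blast
  then show ?thesis using assms by (simp add: transition_def)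
qed

lemma transition_unique:
  assumes "transition u" "transition w"
  shows "u = w"
proof
  fix t
  have "u t \<in> {- \<alpha><..<\<alpha>}" "w t \<in> {- \<alpha><..<\<alpha>}"
    using assms by (auto simp: transition_def abs_less_iff minus_less_iff)
  then show "u t = w t"
    using travel_time_transition[OF assms(1), of t] travel_time_transition[OF assms(2), of t]
      strict_mono_on_eqD[OF travel_time_strict_mono] by metis
qed

text \<open>
  \<open>artanh (x / \<alpha>) / (C * \<alpha>)\<close> is the travel time for the speed
  \<open>C * (\<alpha>\<^sup>2 - x\<^sup>2)\<close>, which is at least the true speed.
\<close>

lemma travel_time_ge:
  assumes "0 \<le> x" "x < \<alpha>"
  shows "artanh (x / \<alpha>) / (C * \<alpha>) \<le> travel_time x"
    and "travel_time (- x) \<le> - (artanh (x / \<alpha>) / (C * \<alpha>))"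
proof -
  let ?F = "\<lambda>x. travel_time x - artanh (x / \<alpha>) / (C * \<alpha>)"
  have der: "\<exists>y. (?F has_real_derivative y) (at x) \<and> 0 \<le> y" if "\<bar>x\<bar> < \<alpha>" for x
  proof -
    have sq: "x\<^sup>2 < \<alpha>\<^sup>2" using that by (rule square_less_if_abs_less)
    have "((\<lambda>x. artanh (x / \<alpha>)) has_real_derivative \<alpha> * 1 / (\<alpha>\<^sup>2 - x\<^sup>2)) (at x)"
      using artanh_scaled_derivative[where u = "\<lambda>x. x", OF alpha_pos that DERIV_ident] by simp
    then have "(?F has_real_derivative 1 / passage_speed x - (\<alpha> * 1 / (\<alpha>\<^sup>2 - x\<^sup>2)) / (C * \<alpha>)) (at x)"
      by (intro DERIV_diff travel_time_has_derivative that DERIV_cdivide)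
    moreover have "(\<alpha> * 1 / (\<alpha>\<^sup>2 - x\<^sup>2)) / (C * \<alpha>) = 1 / (C * (\<alpha>\<^sup>2 - x\<^sup>2))"
      using alpha_pos by simp
    moreover have "1 / (C * (\<alpha>\<^sup>2 - x\<^sup>2)) \<le> 1 / passage_speed x"
      using passage_speed_le[OF that] passage_speed_pos[OF that] C_pos sq by (intro divide_left_mono mult_pos_pos) auto
    ultimately show ?thesis by (intro exI[of _ "1 / passage_speed x - (\<alpha> * 1 / (\<alpha>\<^sup>2 - x\<^sup>2)) / (C * \<alpha>)"]) auto
  qed
  have "?F 0 \<le> ?F x"
    by (rule DERIV_nonneg_imp_nondecreasing[OF assms(1) der]) (use assms in auto)
  moreover have "?F (- x) \<le> ?F 0"
    by (rule DERIV_nonneg_imp_nondecreasing[OF _ der]) (use assms in auto)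
  ultimately show "artanh (x / \<alpha>) / (C * \<alpha>) \<le> travel_time x"
    "travel_time (- x) \<le> - (artanh (x / \<alpha>) / (C * \<alpha>))"
    using assms by (auto simp: artanh_minus_real)
qed

lemma travel_time_onto: "\<exists>x. \<bar>x\<bar> < \<alpha> \<and> travel_time x = t"
proof -
  \<comment> \<open>the point where the lower bound for the travel time equals \<open>\<bar>t\<bar>\<close>\<close>
  define z where "z = \<alpha> * tanh (C * \<alpha> * \<bar>t\<bar>)"
  have z: "0 \<le> z" "z < \<alpha>"
    using alpha_pos C_pos tanh_real_lt_1 by (auto simp: z_def mult_less_cancel_left_pos)
  have cont: "continuous_on {- z..z} travel_time"
    using z by (intro continuous_at_imp_continuous_on ballI DERIV_isCont[OF travel_time_has_derivative]) auto
  have "artanh (z / \<alpha>) / (C * \<alpha>) = \<bar>t\<bar>"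
    using alpha_pos C_pos by (simp add: z_def artanh_tanh_real)
  then have "travel_time (- z) \<le> t" "t \<le> travel_time z"
    using travel_time_ge[OF z] by auto
  then obtain x where "- z \<le> x" "x \<le> z" "travel_time x = t"
    using IVT'[of travel_time "- z" t z] cont z by auto
  then show ?thesis using z by (intro exI[of _ x]) auto
qed

lemma ex_transition: "\<exists>u. transition u"
proof -
  obtain u where u: "\<And>t. \<bar>u t\<bar> < \<alpha>" "\<And>t. travel_time (u t) = t"
    using travel_time_onto by metis
  have mem: "u t \<in> {- \<alpha><..<\<alpha>}" for t using u(1)[of t] by auto
  have "u 0 = 0"
    using strict_mono_on_eqD[OF travel_time_strict_mono _ mem[of 0], of 0] u(2)[of 0] alpha_pos by simp
  moreover have "(u has_real_derivative passage_speed (u t)) (at t)" for t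
  proof -
    have "(u \<longlongrightarrow> u t) (at t)"
      by (rule tendsto_if_strict_mono_image_tendsto[OF travel_time_strict_mono _ mem])
         (use mem u(2) in auto)
    then have "isCont u t" by (simp add: isCont_def)
    then have "(u has_real_derivative inverse (1 / passage_speed (u t))) (at t)"
      using passage_speed_pos[OF u(1)] u(2)
      by (intro DERIV_inverse_function[where f = travel_time and a = "t - 1" and b = "t + 1"]
          travel_time_has_derivative u(1)) (auto simp: less_imp_neq[symmetric])
    then show ?thesis by simp
  qed
  ultimately show ?thesis using u(1) by (auto simp: transition_def)
qed

lemma transition_bounds:
  assumes "transition u" "t \<ge> 0"
  shows "\<alpha> * tanh (c * \<alpha> * t) \<le> u t" "u t \<le> \<alpha> * tanh (C * \<alpha> * t)"
proof -
  have u: "u 0 = 0" "\<bar>u s\<bar> < \<alpha>" "(u has_real_derivative passage_speed (u s)) (at s)" for s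
    using assms(1) by (auto simp: transition_def)
  show "\<alpha> * tanh (c * \<alpha> * t) \<le> u t"
    by (rule tanh_comparison_lower[where u = u, OF alpha_pos assms(2) u passage_speed_ge[OF u(2)]])
  show "u t \<le> \<alpha> * tanh (C * \<alpha> * t)"
    by (rule tanh_comparison_upper[where u = u, OF alpha_pos assms(2) u passage_speed_le[OF u(2)]])
qed

lemma transition_bounds_left:
  assumes "transition u" "t \<le> 0"
  shows "u t \<le> \<alpha> * tanh (c * \<alpha> * t)"
proof -
  have u: "u 0 = 0" "\<bar>u s\<bar> < \<alpha>" "(u has_real_derivative passage_speed (u s)) (at s)" for s
    using assms(1) by (auto simp: transition_def)
  have "\<alpha> * tanh (c * \<alpha> * (- t)) \<le> - u (- (- t))"
  proof (rule tanh_comparison_lower[where u' = "\<lambda>s. passage_speed (u (- s))" and u = "\<lambda>s. - u (- s)", OF alpha_pos])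
    show "((\<lambda>s. - u (- s)) has_real_derivative passage_speed (u (- s))) (at s)" for s
      by (rule reflect_derivative[OF u(3)])
    show "c * (\<alpha>\<^sup>2 - (- u (- s))\<^sup>2) \<le> passage_speed (u (- s))" for s
      using passage_speed_ge[OF u(2)[of "- s"]] by simp
  qed (use assms(2) u(1,2) in auto)
  then show ?thesis by simp
qed

text \<open>
  Along the solution \<open>passage_speed\<close> stays in the range where \<open>kinetic\<close> has the nonzero derivative
  \<open>s * dflux s\<close>, so \<open>u'' = V'(u) / dflux (u')\<close> exists, and multiplication by \<open>dflux (u')\<close> gives the
  equation.  For the Hoelder condition on \<open>u'\<close> it suffices to bound \<open>u''\<close> locally; replacing
  \<open>dflux\<close> by its lower bound \<open>(l - 1) * \<phi>\<close> gives a bound that is visibly continuous.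
\<close>

lemma transition_regular:
  assumes "transition u"
  shows "regular_heteroclinic_solution \<phi> V \<alpha> u"
proof -
  have u0: "u 0 = 0" and u: "\<bar>u t\<bar> < \<alpha>" "(u has_real_derivative passage_speed (u t)) (at t)" for t
    using assms by (auto simp: transition_def)
  have deriv_u: "deriv u = (\<lambda>t. passage_speed (u t))"
    using u(2) by (auto intro: DERIV_imp_deriv)
  have vpos: "passage_speed (u t) > 0" for t using passage_speed_pos u(1) by blast
  note dpos = dflux_pos[OF vpos]
  have du: "((\<lambda>t. passage_speed (u t)) has_real_derivative deriv V (u t) / dflux (passage_speed (u t))) (at t)" for t
    using DERIV_chain2[where f = passage_speed, OF passage_speed_has_derivative[OF u(1)] u(2), of t] vpos[of t] by simp
  have flux_eq: "((\<lambda>s. flux (passage_speed (u s))) has_real_derivative deriv V (u t)) (at t)" for t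
    using DERIV_chain2[where f = flux, OF flux_has_derivative[OF vpos] du, of t] dpos[of t] by simp
  have flux_deriv: "(\<lambda>s. \<phi> \<bar>deriv u s\<bar> * deriv u s) = (\<lambda>s. flux (passage_speed (u s)))"
    by (simp add: deriv_u flux_def)
  have top: "(u \<longlongrightarrow> \<alpha>) at_top"
  proof (rule tendsto_sandwich)
    show "eventually (\<lambda>t. \<alpha> * tanh (c * \<alpha> * t) \<le> u t) at_top"
      using eventually_ge_at_top[of 0] by eventually_elim (rule transition_bounds[OF assms])
    show "eventually (\<lambda>t. u t \<le> \<alpha>) at_top"
      using u(1) by (intro always_eventually) (auto simp: abs_less_iff intro: less_imp_le)
    have "filterlim (\<lambda>t. c * \<alpha> * t) at_top at_top"
      using c_pos alpha_pos by (intro filterlim_tendsto_pos_mult_at_top[OF tendsto_const] filterlim_ident) auto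
    from tendsto_mult[OF tendsto_const[of \<alpha>] filterlim_compose[OF tanh_real_at_top this]]
    show "((\<lambda>t. \<alpha> * tanh (c * \<alpha> * t)) \<longlongrightarrow> \<alpha>) at_top" by simp
  qed simp
  have bot: "(u \<longlongrightarrow> - \<alpha>) at_bot"
  proof (rule tendsto_sandwich)
    show "eventually (\<lambda>t. u t \<le> \<alpha> * tanh (c * \<alpha> * t)) at_bot"
      using eventually_le_at_bot[of 0] by eventually_elim (rule transition_bounds_left[OF assms])
    show "eventually (\<lambda>t. - \<alpha> \<le> u t) at_bot"
      using u(1) by (intro always_eventually) (auto simp: abs_less_iff minus_less_iff intro: less_imp_le)
    have "filterlim (\<lambda>t. c * \<alpha> * t) at_bot at_bot"
      using c_pos alpha_pos by (intro filterlim_tendsto_pos_mult_at_bot[OF tendsto_const] filterlim_ident) auto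
    from tendsto_mult[OF tendsto_const[of \<alpha>] filterlim_compose[OF tanh_real_at_bot this]]
    show "((\<lambda>t. \<alpha> * tanh (c * \<alpha> * t)) \<longlongrightarrow> - \<alpha>) at_bot" by simp
  qed simp
  have cont_u: "continuous_on UNIV u" and cont_du: "continuous_on UNIV (\<lambda>t. passage_speed (u t))"
    using u(2) du by (auto intro!: continuous_at_imp_continuous_on intro: DERIV_isCont)
  have holder: "holder_continuous_on (1/2) K (deriv u)" if "compact K" for K
    unfolding deriv_u
  proof (rule holder_on_compact_if_derivative_bounded[OF du _ _ that])
    let ?b = "\<lambda>t. \<bar>deriv V (u t)\<bar> / ((l - 1) * \<phi> (passage_speed (u t)))"
    have phi_cont: "continuous_on {0<..} \<phi>"
      using phi_differentiable
      by (intro continuous_at_imp_continuous_on) (auto intro: differentiable_imp_continuous_within)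
    show "continuous_on UNIV ?b"
      using vpos phi_pos[OF vpos] l_gt_1
      by (intro continuous_intros continuous_on_compose2[OF deriv_V_continuous_on cont_u]
          continuous_on_compose2[OF phi_cont cont_du]) (auto simp: less_imp_neq[symmetric])
    show "\<bar>deriv V (u t) / dflux (passage_speed (u t))\<bar> \<le> ?b t" for t
      using flux_deriv_ge[OF vpos, of t] phi_pos[OF vpos, of t] l_gt_1 dpos[of t]
      by (auto simp: dflux_def abs_divide intro!: divide_left_mono mult_pos_pos)
  qed
  have C1: "u C1_differentiable_on UNIV"
    unfolding C1_differentiable_on_def
    using u(2) cont_du
    by (intro exI[of _ "\<lambda>t. passage_speed (u t)"])
       (auto simp: has_real_derivative_iff_has_vector_derivative[symmetric])
  have "heteroclinic_solution \<phi> V \<alpha> u"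
    unfolding heteroclinic_solution_def flux_deriv
    using u(2) flux_eq DERIV_imp_deriv[OF flux_eq] u0 top bot real_differentiable_def by auto
  moreover have "twice_differentiable u"
    unfolding twice_differentiable_def deriv_u using u(2) du real_differentiable_def by blast
  moreover have "C1_holder_loc (1/2) u"
    unfolding C1_holder_loc_def using C1 holder by blast
  ultimately show ?thesis
    unfolding regular_heteroclinic_solution_def by (intro conjI exI[of _ "1/2"]) auto
qed

lemma regular_heteroclinic_iff_transition:
  "regular_heteroclinic_solution \<phi> V \<alpha> u \<longleftrightarrow> transition u"
  using transition_regular transition_if_heteroclinic
  by (auto simp: regular_heteroclinic_solution_def)

lemma ex1_regular_heteroclinic: "\<exists>!u. regular_heteroclinic_solution \<phi> V \<alpha> u"
  unfolding regular_heteroclinic_iff_transition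
  using ex_transition transition_unique by blast

text \<open>
  The bound on \<open>\<alpha> - u\<close> is the comparison with \<open>tanh\<close>; the bound on \<open>u'\<close> follows from it since
  \<open>u' \<le> C * (\<alpha> + u) * (\<alpha> - u)\<close> with \<open>\<alpha> + u \<le> 2 * \<alpha>\<close>.  On the left the two factors exchange
  their roles.
\<close>

lemma transition_decay:
  assumes "transition u" "t \<ge> 0"
  shows "\<alpha> - u t \<le> 2 * \<alpha> * exp (- (2 * c * \<alpha>) * t)"
    and "deriv u t \<le> 4 * \<alpha>\<^sup>2 * C * exp (- (2 * c * \<alpha>) * t)"
proof -
  have u: "\<bar>u t\<bar> < \<alpha>" and der: "deriv u t = passage_speed (u t)"
    using assms(1) by (auto simp: transition_def intro: DERIV_imp_deriv)
  have "\<alpha> - u t \<le> \<alpha> * (1 - tanh (c * \<alpha> * t))"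
    using transition_bounds(1)[OF assms] by (simp add: algebra_simps)
  also have "\<dots> \<le> \<alpha> * (2 * exp (- 2 * (c * \<alpha> * t)))"
    using alpha_pos by (intro mult_left_mono one_minus_tanh_le) auto
  finally show dec: "\<alpha> - u t \<le> 2 * \<alpha> * exp (- (2 * c * \<alpha>) * t)"
    by (simp add: mult.assoc)
  have "deriv u t \<le> C * ((\<alpha> + u t) * (\<alpha> - u t))"
    using passage_speed_le[OF u] by (simp add: der power2_eq_square algebra_simps)
  also have "\<dots> \<le> C * (2 * \<alpha> * (2 * \<alpha> * exp (- (2 * c * \<alpha>) * t)))"
    using u alpha_pos C_pos dec by (intro mult_left_mono mult_mono) auto
  finally show "deriv u t \<le> 4 * \<alpha>\<^sup>2 * C * exp (- (2 * c * \<alpha>) * t)"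
    by (simp add: power2_eq_square mult_ac)
qed

lemma transition_decay_left:
  assumes "transition u" "t \<le> 0"
  shows "\<alpha> + u t \<le> 2 * \<alpha> * exp (2 * c * \<alpha> * t)"
    and "deriv u t \<le> 4 * \<alpha>\<^sup>2 * C * exp (2 * c * \<alpha> * t)"
proof -
  have u: "\<bar>u t\<bar> < \<alpha>" and der: "deriv u t = passage_speed (u t)"
    using assms(1) by (auto simp: transition_def intro: DERIV_imp_deriv)
  have "\<alpha> + u t \<le> \<alpha> * (1 - tanh (- (c * \<alpha> * t)))"
    using transition_bounds_left[OF assms] by (simp add: algebra_simps)
  also have "\<dots> \<le> \<alpha> * (2 * exp (- 2 * (- (c * \<alpha> * t))))"
    using alpha_pos by (intro mult_left_mono one_minus_tanh_le) auto
  finally show dec: "\<alpha> + u t \<le> 2 * \<alpha> * exp (2 * c * \<alpha> * t)"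
    by (simp add: mult.assoc)
  have "deriv u t \<le> C * ((\<alpha> - u t) * (\<alpha> + u t))"
    using passage_speed_le[OF u] by (simp add: der power2_eq_square algebra_simps)
  also have "\<dots> \<le> C * (2 * \<alpha> * (2 * \<alpha> * exp (2 * c * \<alpha> * t)))"
    using u alpha_pos C_pos dec by (intro mult_left_mono mult_mono) auto
  finally show "deriv u t \<le> 4 * \<alpha>\<^sup>2 * C * exp (2 * c * \<alpha> * t)"
    by (simp add: power2_eq_square mult_ac)
qed

end

section \<open>The potential \<open>\<Phi>(|t\<^sup>2 - \<alpha>\<^sup>2|)\<close> and the main result\<close>

context phi_laplacian
begin

text \<open>
  Here \<open>V x = Phi \<phi> (\<alpha>\<^sup>2 - x\<^sup>2)\<close> is itself the value of \<open>Phi\<close> at the weight, so the bounds required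
  of a double well are those of \<open>kinetic\<close> by \<open>Phi\<close> with factor \<open>1\<close>.
\<close>

lemma tanh_bounds_Phi_potential:
  assumes "\<alpha> > 0" "V C1_differentiable_on UNIV"
    and V: "\<And>x. V x = Phi \<phi> \<bar>x\<^sup>2 - \<alpha>\<^sup>2\<bar>"
    and u: "regular_heteroclinic_solution \<phi> V \<alpha> u" and "t \<ge> 0"
  shows "\<alpha> * tanh (min 1 (1 / (m - 1)) * \<alpha> * t) \<le> u t"
    and "u t \<le> \<alpha> * tanh (max 1 (1 / (l - 1)) * \<alpha> * t)"
proof -
  let ?c = "min 1 (1 / (m - 1))" and ?C = "max 1 (1 / (l - 1))"
  have V': "V x = Phi \<phi> (\<alpha>\<^sup>2 - x\<^sup>2)" for x
    unfolding V by (metis Phi_abs abs_minus_commute)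
  interpret W: double_well \<phi> l m V \<alpha> ?c ?C
  proof
    fix x assume "\<bar>x\<bar> < \<alpha>"
    then have y: "0 < \<alpha>\<^sup>2 - x\<^sup>2" using square_less_if_abs_less by simp
    then show "0 < V x" by (simp add: V' Phi_pos)
    show "kinetic (?c * (\<alpha>\<^sup>2 - x\<^sup>2)) \<le> V x"
      using y by (intro kinetic_scaled_le_if_Phi_le) (auto simp: V')
    show "V x \<le> kinetic (?C * (\<alpha>\<^sup>2 - x\<^sup>2))"
      using y by (intro le_kinetic_scaled_if_le_Phi) (auto simp: V')
  qed (use assms m_gt_1 in \<open>auto simp: V'\<close>)
  have "W.transition u" using u by (simp add: W.regular_heteroclinic_iff_transition)
  then show "\<alpha> * tanh (?c * \<alpha> * t) \<le> u t" "u t \<le> \<alpha> * tanh (?C * \<alpha> * t)"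
    using W.transition_bounds \<open>t \<ge> 0\<close> by auto
qed

end

theorem theorem1p1:
  fixes \<phi> V :: "real \<Rightarrow> real" and l m \<alpha> :: real
  assumes phi_C1: "\<phi> C1_differentiable_on {0<..}"
    and phi_nonneg: "\<forall>t>0. 0 \<le> \<phi> t"
    and phi_1: "\<forall>t>0. 0 < \<phi> t \<and> 0 < deriv (\<lambda>s. \<phi> s * s) t"
    and phi_2: "1 < l" "l \<le> m"
      "\<forall>t>0. l - 1 \<le> deriv (\<lambda>s. \<phi> s * s) t / \<phi> t \<and> deriv (\<lambda>s. \<phi> s * s) t / \<phi> t \<le> m - 1"
    and phi_3: "\<exists>k\<^sub>1 k\<^sub>2 \<delta>\<^sub>0 \<sigma>. 0 < k\<^sub>1 \<and> 0 < k\<^sub>2 \<and> 0 < \<delta>\<^sub>0 \<and> 1 < \<sigma> \<and>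
      (\<forall>t\<in>{0<..\<delta>\<^sub>0}. k\<^sub>1 * t powr (\<sigma> - 1) \<le> \<phi> t * t \<and> \<phi> t * t \<le> k\<^sub>2 * t powr (\<sigma> - 1))"
    and V_1: "V C1_differentiable_on UNIV" "\<forall>t. 0 \<le> V t"
    and V_2: "0 < \<alpha>" "V \<alpha> = 0" "V (- \<alpha>) = 0" "\<forall>t\<in>{- \<alpha><..<\<alpha>}. 0 < V t"
    and V_3: "\<exists>a\<^sub>1 a\<^sub>2 a\<^sub>3 a\<^sub>4 \<delta>. 0 < a\<^sub>1 \<and> 0 < a\<^sub>2 \<and> 0 < a\<^sub>3 \<and> 0 < a\<^sub>4 \<and> 0 < \<delta> \<and> \<delta> < \<alpha> \<and>
      (\<forall>t\<in>{\<alpha> - \<delta><..\<alpha>}. a\<^sub>1 * Phi \<phi> \<bar>t - \<alpha>\<bar> \<le> V t \<and> V t \<le> a\<^sub>2 * Phi \<phi> \<bar>t - \<alpha>\<bar>) \<and>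
      (\<forall>t\<in>{- \<alpha>..<- \<alpha> + \<delta>}. a\<^sub>3 * Phi \<phi> \<bar>t + \<alpha>\<bar> \<le> V t \<and> V t \<le> a\<^sub>4 * Phi \<phi> \<bar>t + \<alpha>\<bar>)"
    and V_4: "\<exists>c\<^sub>1 c\<^sub>2 c\<^sub>3 c\<^sub>4 c\<^sub>5 c\<^sub>6 c\<^sub>7 c\<^sub>8.
      0 < c\<^sub>1 \<and> 0 < c\<^sub>2 \<and> 0 < c\<^sub>3 \<and> 0 < c\<^sub>4 \<and> 0 < c\<^sub>5 \<and> 0 < c\<^sub>6 \<and> 0 < c\<^sub>7 \<and> 0 < c\<^sub>8 \<and>
      (\<forall>t\<in>{0..\<alpha>}.
        - c\<^sub>3 * t * \<phi> (c\<^sub>4 * \<bar>t - \<alpha>\<bar>) * \<bar>t - \<alpha>\<bar> \<le> deriv V t \<and>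
        deriv V t \<le> - c\<^sub>1 * t * \<phi> (c\<^sub>2 * \<bar>t - \<alpha>\<bar>) * \<bar>t - \<alpha>\<bar>) \<and>
      (\<forall>t\<in>{- \<alpha>..0}.
        - c\<^sub>7 * t * \<phi> (c\<^sub>8 * \<bar>t + \<alpha>\<bar>) * \<bar>t + \<alpha>\<bar> \<le> deriv V t \<and>
        deriv V t \<le> - c\<^sub>5 * t * \<phi> (c\<^sub>6 * \<bar>t + \<alpha>\<bar>) * \<bar>t + \<alpha>\<bar>)"
    and V_5: "\<exists>\<rho>>0. strictly_convex_on {- \<alpha> - \<rho><..<- \<alpha> + \<rho>} V \<and>
      strictly_convex_on {\<alpha> - \<rho><..<\<alpha> + \<rho>} V"
  shows "(\<exists>!q. regular_heteroclinic_solution \<phi> V \<alpha> q) \<and>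
    (\<forall>q. regular_heteroclinic_solution \<phi> V \<alpha> q \<longrightarrow>
      (0 \<le> \<phi> 0 \<and> mono_on {0..} \<phi> \<longrightarrow>
        (\<exists>\<theta>\<^sub>1 \<theta>\<^sub>2 \<theta>\<^sub>3 \<theta>\<^sub>4 \<beta>\<^sub>1 \<beta>\<^sub>2 \<beta>\<^sub>3 \<beta>\<^sub>4.
          0 < \<theta>\<^sub>1 \<and> 0 < \<theta>\<^sub>2 \<and> 0 < \<theta>\<^sub>3 \<and> 0 < \<theta>\<^sub>4 \<and>
          0 < \<beta>\<^sub>1 \<and> 0 < \<beta>\<^sub>2 \<and> 0 < \<beta>\<^sub>3 \<and> 0 < \<beta>\<^sub>4 \<and>
          (\<forall>t\<ge>0. 0 < \<alpha> - q t \<and> \<alpha> - q t \<le> \<theta>\<^sub>1 * exp (- \<theta>\<^sub>2 * t) \<and>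
                 0 < deriv q t \<and> deriv q t \<le> \<beta>\<^sub>1 * exp (- \<beta>\<^sub>2 * t)) \<and>
          (\<forall>t\<le>0. 0 < \<alpha> + q t \<and> \<alpha> + q t \<le> \<theta>\<^sub>3 * exp (\<theta>\<^sub>4 * t) \<and>
                 0 < deriv q t \<and> deriv q t \<le> \<beta>\<^sub>3 * exp (\<beta>\<^sub>4 * t)))) \<and>
      ((\<forall>t. V t = Phi \<phi> \<bar>t^2 - \<alpha>^2\<bar>) \<longrightarrow>
        (l - 1 \<le> 1 \<and> 1 \<le> m - 1 \<longrightarrow>
          (\<forall>t\<ge>0. \<alpha> * tanh (\<alpha> * t / (m - 1)) \<le> q t \<and> q t \<le> \<alpha> * tanh (\<alpha> * t / (l - 1)))) \<and>
        (1 < l - 1 \<longrightarrow>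
          (\<forall>t\<ge>0. \<alpha> * tanh (\<alpha> * t / (m - 1)) \<le> q t \<and> q t \<le> \<alpha> * tanh (\<alpha> * t))) \<and>
        (m - 1 < 1 \<longrightarrow>
          (\<forall>t\<ge>0. \<alpha> * tanh (\<alpha> * t) \<le> q t \<and> q t \<le> \<alpha> * tanh (\<alpha> * t / (l - 1))))))"
proof -
  interpret phi_laplacian \<phi> l m
  proof
    show "\<phi> differentiable (at t)" if "t > 0" for t
      using phi_C1 that by (simp add: C1_differentiable_on_eq)
    show "(l - 1) * \<phi> t \<le> deriv (\<lambda>s. \<phi> s * s) t" "deriv (\<lambda>s. \<phi> s * s) t \<le> (m - 1) * \<phi> t"
      if "t > 0" for t
      using phi_1 phi_2(3) that by (simp_all add: pos_le_divide_eq pos_divide_le_eq)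
    obtain k\<^sub>1 k\<^sub>2 \<delta>\<^sub>0 \<sigma> where "0 < k\<^sub>1" "0 < \<delta>\<^sub>0" "1 < \<sigma>" and *: "\<forall>t\<in>{0<..\<delta>\<^sub>0}.
        k\<^sub>1 * t powr (\<sigma> - 1) \<le> \<phi> t * t \<and> \<phi> t * t \<le> k\<^sub>2 * t powr (\<sigma> - 1)"
      using phi_3 by blast
    show "((\<lambda>t. \<phi> t * t) \<longlongrightarrow> 0) (at_right 0)"
    proof (rule powr_bound_tendsto_0[of "\<sigma> - 1" \<delta>\<^sub>0 _ k\<^sub>2])
      show "0 \<le> \<phi> t * t \<and> \<phi> t * t \<le> k\<^sub>2 * t powr (\<sigma> - 1)" if "0 < t" "t \<le> \<delta>\<^sub>0" for t
        using * phi_1 that by (auto intro: less_imp_le)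
    qed (use \<open>0 < \<delta>\<^sub>0\<close> \<open>1 < \<sigma>\<close> in auto)
  qed (use phi_1 phi_2 in auto)
  have V_pos: "0 < V x" if "\<bar>x\<bar> < \<alpha>" for x
    using V_2(4) that by (auto simp: abs_less_iff)
  have V_cont: "continuous_on UNIV V"
    using V_1(1) C1_differentiable_imp_continuous_on by blast
  obtain a\<^sub>1 a\<^sub>2 a\<^sub>3 a\<^sub>4 \<delta> where a: "0 < a\<^sub>1" "0 < a\<^sub>2" "0 < a\<^sub>3" "0 < a\<^sub>4" and \<delta>: "0 < \<delta>" "\<delta> < \<alpha>"
    and right: "\<forall>t\<in>{\<alpha> - \<delta><..\<alpha>}. a\<^sub>1 * Phi \<phi> \<bar>t - \<alpha>\<bar> \<le> V t \<and> V t \<le> a\<^sub>2 * Phi \<phi> \<bar>t - \<alpha>\<bar>"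
    and left: "\<forall>t\<in>{- \<alpha>..<- \<alpha> + \<delta>}. a\<^sub>3 * Phi \<phi> \<bar>t + \<alpha>\<bar> \<le> V t \<and> V t \<le> a\<^sub>4 * Phi \<phi> \<bar>t + \<alpha>\<bar>"
    using V_3 by blast
  have "\<exists>c>0. \<exists>C>0. \<forall>x. \<bar>x\<bar> < \<alpha> \<longrightarrow>
      kinetic (c * (\<alpha>\<^sup>2 - x\<^sup>2)) \<le> V x \<and> V x \<le> kinetic (C * (\<alpha>\<^sup>2 - x\<^sup>2))"
  \<comment> \<open>one pair of constants for both wells\<close>
  proof (rule ex_well_bounds[where \<delta> = \<delta> and a = "min a\<^sub>1 a\<^sub>3" and b = "max a\<^sub>2 a\<^sub>4"])
    fix x assume x: "\<alpha> - \<delta> < \<bar>x\<bar>" "\<bar>x\<bar> < \<alpha>"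
    let ?P = "Phi \<phi> (\<alpha> - \<bar>x\<bar>)"
    have P: "?P \<ge> 0" using Phi_pos[of "\<alpha> - \<bar>x\<bar>"] x by simp
    have m: "min a\<^sub>1 a\<^sub>3 * ?P \<le> a\<^sub>1 * ?P" "min a\<^sub>1 a\<^sub>3 * ?P \<le> a\<^sub>3 * ?P"
      "a\<^sub>2 * ?P \<le> max a\<^sub>2 a\<^sub>4 * ?P" "a\<^sub>4 * ?P \<le> max a\<^sub>2 a\<^sub>4 * ?P"
      using P by (auto intro!: mult_right_mono)
    show "min a\<^sub>1 a\<^sub>3 * ?P \<le> V x \<and> V x \<le> max a\<^sub>2 a\<^sub>4 * ?P"
    proof (cases "x \<ge> 0")
      case True
      then have dist: "\<bar>x - \<alpha>\<bar> = \<alpha> - \<bar>x\<bar>" and "x \<in> {\<alpha> - \<delta><..\<alpha>}" using x by auto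
      from bspec[OF right this(2)] m show ?thesis unfolding dist by linarith
    next
      case False
      then have dist: "\<bar>x + \<alpha>\<bar> = \<alpha> - \<bar>x\<bar>" and "x \<in> {- \<alpha>..<- \<alpha> + \<delta>}" using x by auto
      from bspec[OF left this(2)] m show ?thesis unfolding dist by linarith
    qed
  qed (use V_2(1) \<delta> a V_cont V_pos in auto)
  then obtain c C where "0 < c" "0 < C" and bounds: "\<And>x. \<bar>x\<bar> < \<alpha> \<Longrightarrow>
      kinetic (c * (\<alpha>\<^sup>2 - x\<^sup>2)) \<le> V x \<and> V x \<le> kinetic (C * (\<alpha>\<^sup>2 - x\<^sup>2))"
    by blast
  interpret double_well \<phi> l m V \<alpha> c C
    using V_1(1) V_2 V_pos \<open>0 < c\<close> \<open>0 < C\<close> bounds by unfold_locales auto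
  have decay: "\<exists>\<theta>\<^sub>1 \<theta>\<^sub>2 \<theta>\<^sub>3 \<theta>\<^sub>4 \<beta>\<^sub>1 \<beta>\<^sub>2 \<beta>\<^sub>3 \<beta>\<^sub>4.
      0 < \<theta>\<^sub>1 \<and> 0 < \<theta>\<^sub>2 \<and> 0 < \<theta>\<^sub>3 \<and> 0 < \<theta>\<^sub>4 \<and> 0 < \<beta>\<^sub>1 \<and> 0 < \<beta>\<^sub>2 \<and> 0 < \<beta>\<^sub>3 \<and> 0 < \<beta>\<^sub>4 \<and>
      (\<forall>t\<ge>0. 0 < \<alpha> - q t \<and> \<alpha> - q t \<le> \<theta>\<^sub>1 * exp (- \<theta>\<^sub>2 * t) \<and>
             0 < deriv q t \<and> deriv q t \<le> \<beta>\<^sub>1 * exp (- \<beta>\<^sub>2 * t)) \<and>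
      (\<forall>t\<le>0. 0 < \<alpha> + q t \<and> \<alpha> + q t \<le> \<theta>\<^sub>3 * exp (\<theta>\<^sub>4 * t) \<and>
             0 < deriv q t \<and> deriv q t \<le> \<beta>\<^sub>3 * exp (\<beta>\<^sub>4 * t))"
    if "regular_heteroclinic_solution \<phi> V \<alpha> q" for q
  proof -
    have q: "transition q" using that by (simp add: regular_heteroclinic_iff_transition)
    have dq: "0 < deriv q t" and "\<bar>q t\<bar> < \<alpha>" for t
    proof -
      show "\<bar>q t\<bar> < \<alpha>" using q by (simp add: transition_def)
      moreover have "deriv q t = passage_speed (q t)"
        using q by (auto simp: transition_def intro: DERIV_imp_deriv)
      ultimately show "0 < deriv q t" by (simp add: passage_speed_pos)
    qed
    have gap: "0 < \<alpha> - q t" "0 < \<alpha> + q t" for t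
      using \<open>\<bar>q t\<bar> < \<alpha>\<close> by linarith+
    have pos: "0 < 2 * \<alpha>" "0 < 2 * c * \<alpha>" "0 < 4 * \<alpha>\<^sup>2 * C"
      using alpha_pos c_pos C_pos by simp_all
    show ?thesis
      apply (rule exI[of _ "2 * \<alpha>"], rule exI[of _ "2 * c * \<alpha>"])
      apply (rule exI[of _ "2 * \<alpha>"], rule exI[of _ "2 * c * \<alpha>"])
      apply (rule exI[of _ "4 * \<alpha>\<^sup>2 * C"], rule exI[of _ "2 * c * \<alpha>"])
      apply (rule exI[of _ "4 * \<alpha>\<^sup>2 * C"], rule exI[of _ "2 * c * \<alpha>"])
      apply (intro conjI allI impI)
      apply (rule pos gap dq
          | (rule transition_decay[OF q] transition_decay_left[OF q], assumption))+
      done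
  qed
  have tanh_bounds: "\<alpha> * tanh (min 1 (1 / (m - 1)) * \<alpha> * t) \<le> q t"
      "q t \<le> \<alpha> * tanh (max 1 (1 / (l - 1)) * \<alpha> * t)"
    if "\<forall>t. V t = Phi \<phi> \<bar>t^2 - \<alpha>^2\<bar>" "regular_heteroclinic_solution \<phi> V \<alpha> q" "t \<ge> 0" for q t
    using tanh_bounds_Phi_potential[OF V_2(1) V_1(1) _ that(2,3)] that(1) by blast+
  have lower: "1 \<le> m - 1 \<Longrightarrow> \<alpha> * tanh (\<alpha> * t / (m - 1)) \<le> q t"
      "m - 1 < 1 \<Longrightarrow> \<alpha> * tanh (\<alpha> * t) \<le> q t"
    and upper: "l - 1 \<le> 1 \<Longrightarrow> q t \<le> \<alpha> * tanh (\<alpha> * t / (l - 1))"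
      "1 < l - 1 \<Longrightarrow> q t \<le> \<alpha> * tanh (\<alpha> * t)"
    if "\<forall>t. V t = Phi \<phi> \<bar>t^2 - \<alpha>^2\<bar>" "regular_heteroclinic_solution \<phi> V \<alpha> q" "t \<ge> 0" for q t
  proof -
    have "min 1 (1 / (m - 1)) = (if 1 \<le> m - 1 then 1 / (m - 1) else 1)"
      and "max 1 (1 / (l - 1)) = (if l - 1 \<le> 1 then 1 / (l - 1) else 1)"
      using l_gt_1 m_gt_1 by (simp_all add: min_def max_def divide_le_eq le_divide_eq)
    with tanh_bounds[OF that]
    show "1 \<le> m - 1 \<Longrightarrow> \<alpha> * tanh (\<alpha> * t / (m - 1)) \<le> q t"
      "m - 1 < 1 \<Longrightarrow> \<alpha> * tanh (\<alpha> * t) \<le> q t"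
      "l - 1 \<le> 1 \<Longrightarrow> q t \<le> \<alpha> * tanh (\<alpha> * t / (l - 1))"
      "1 < l - 1 \<Longrightarrow> q t \<le> \<alpha> * tanh (\<alpha> * t)"
      by simp_all
  qed
  have l_le_m: "l - 1 \<le> m - 1" using phi_2(2) by simp
  show ?thesis
    by (intro conjI allI impI; (rule ex1_regular_heteroclinic | rule decay lower upper);
        (assumption | elim conjE, assumption | use l_le_m in linarith))
qed

end
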